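(* Let $A\in\mathbb{R}^{n\times n}$, $b,c\in\mathbb{R}^n$ with $(A,b)$ controllable and $(c^\top,A)$ observable. Let $\Lambda=\operatorname{diag}(-\lambda_1,\dots,-\lambda_n)$ with $0<\lambda_1<\dots<\lambda_n$, let $\ell=(\gamma_1,\dots,\gamma_n)^\top$ with all $\gamma_i\neq0$, and let $T>0$, $N\in\mathbb{N}$, $N\ge1$, $T_{\mathrm s}=T/N$. Let $(u(t),y(t))$, $t\in[0,T]$, be an input-output trajectory of the single-input single-output system $\dot x=Ax+bu$, $y=c^\top x$, and let $U\in\mathbb{R}^{1\times N}$, $Z_{\mathrm a},\dot Z_{\mathrm a}\in\mathbb{R}^{3n\times N}$ be the data batches built from it as described in the context. Consider the following linear matrix inequality (LMI) in the unknown $Q\in\mathbb{R}^{N\times 3n}$: $$\dot Z_{\mathrm a}Q+Q^\top\dot Z_{\mathrm a}^\top\prec0,\qquad Z_{\mathrm a}Q=Q^\top Z_{\mathrm a}^\top\succ0.\quad(\ast)$$ Then: 1. The LMI $(\ast)$ is feasible (i.e. has a solution $Q$) if the data batch is exciting, i.e. if $$\operatorname{rank}\begin{bmatrix}Z_{\mathrm a} \\ U\end{bmatrix}=3n+1.$$ 2. For any solution $Q$ of $(\ast)$, the gain $$K=UQ(Z_{\mathrm a}Q)^{-1}\begin{bmatrix}0 \\ I_{2n}\end{bmatrix}\in\mathbb{R}^{1\times2n}$$ (where the zero block is $n\times 2n$) is such that $F+gK$ is Hurwitz, with $F$ and $g$ as defined in the context. As a consequence, the origin $(x,\hat\zeta_{\mathrm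 c})=0$ of the closed-loop interconnection of the plant $\dot x=Ax+bu$, $y=c^\top x$ with the controller $$\dot{\hat\zeta}_{\mathrm c}=\begin{bmatrix}\Lambda&0 \\ 0&\Lambda\end{bmatrix}\hat\zeta_{\mathrm c}+\begin{bmatrix}\ell&0 \\ 0&\ell\end{bmatrix}\begin{bmatrix}y \\ u\end{bmatrix},\qquad u=K\hat\zeta_{\mathrm c},\qquad\hat\zeta_{\mathrm c}\in\mathbb{R}^{2n},$$ is globally exponentially stable.
   Context: Construction of the data batches. Given an input signal $u:[0,T]\to\mathbb{R}$ and the corresponding output $y:[0,T]\to\mathbb{R}$ of $\dot x=Ax+bu$, $y=c^\top x$ (any initial condition $x(0)$), let $\hat\zeta:[0,T]\to\mathbb{R}^{2n}$ and $\chi:[0,T]\to\mathbb{R}^n$ solve $$\dot{\hat\zeta}(t)=\begin{bmatrix}\Lambda&0 \\ 0&\Lambda\end{bmatrix}\hat\zeta(t)+\begin{bmatrix}\ell&0 \\ 0&\ell\end{bmatrix}\begin{bmatrix}y(t) \\ u(t)\end{bmatrix},\quad\hat\zeta(0)=0,\qquad\dot\chi(t)=\Lambda\chi(t),\quad\chi(0)=[1\;\cdots\;1]^\top,$$ where derivatives at sampling instants denote the value of the right-hand side at that time. The batches are $$U=\begin{bmatrix}u(0)&u(T_{\mathrm s})&\cdots&u((N-1)T_{\mathrm s})\end{bmatrix},$$ $$Z_{\mathrm a}=\begin{bmatrix}\begin{bmatrix}\chi(0) \\ \hat\zeta(0)\end{bmatrix}&\cdots&\begin{bmatrix}\chi((N-1)T_{\mathrm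 s}) \\ \hat\zeta((N-1)T_{\mathrm s})\end{bmatrix}\end{bmatrix},\quad\dot Z_{\mathrm a}=\begin{bmatrix}\begin{bmatrix}\dot\chi(0) \\ \dot{\hat\zeta}(0)\end{bmatrix}&\cdots&\begin{bmatrix}\dot\chi((N-1)T_{\mathrm s}) \\ \dot{\hat\zeta}((N-1)T_{\mathrm s})\end{bmatrix}\end{bmatrix}.$$ Definition of $F$ and $g$. Let $\Pi\in\mathbb{R}^{n\times2n}$ be a full rank matrix and $\theta_1,\theta_2\in\mathbb{R}^n$ be vectors such that $$\Pi\begin{bmatrix}\Lambda+\ell\theta_1^\top&\ell\theta_2^\top \\ 0&\Lambda\end{bmatrix}=A\Pi,\qquad\Pi\begin{bmatrix}0 \\ \ell\end{bmatrix}=b,\qquad\begin{bmatrix}\theta_1^\top&\theta_2^\top\end{bmatrix}=c^\top\Pi$$ (such $\Pi,\theta_1,\theta_2$ exist under the stated hypotheses). Then $$F=\begin{bmatrix}\Lambda+\ell\theta_1^\top&\ell\theta_2^\top \\ 0&\Lambda\end{bmatrix}\in\mathbb{R}^{2n\times2n},\qquad g=\begin{bmatrix}0 \\ \ell\end{bmatrix}\in\mathbb{R}^{2n}.$$ Notation: for a symmetric matrix $M$, $M\succ0$ (resp. $M\prec0$) means positive (resp. negative) definite; $Z_{\mathrm a}Q=Q^\top Z_{\mathrm a}^\top\succ0$ means $Z_{\mathrm a}Q$ is symmetric and positive definite. A matrix is Hurwitz if all its eigenvalues have negative real part. *)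

theory Defs
  imports "HOL-Analysis.Analysis"
begin

text \<open>
  Sizes are index types: \<open>'n\<close> for the state dimension and \<open>'N\<close> for the number of samples. Where the
  numerical value of an index matters, the type is a finite linear order and \<open>card {..<i}\<close> is the
  zero-based position of \<open>i\<close>.
\<close>

section \<open>Block matrices\<close>

text \<open>A matrix is a vector of rows, so \<open>vstack\<close> stacks both vectors and matrices.\<close>

definition vstack :: "'a ^ 'm \<Rightarrow> 'a ^ 'k \<Rightarrow> 'a ^ ('m + 'k)" where
  "vstack p q = (\<chi> i. case i of Inl j \<Rightarrow> p $ j | Inr j \<Rightarrow> q $ j)"

definition hstack :: "'a ^ 'p ^ 'm \<Rightarrow> 'a ^ 'q ^ 'm \<Rightarrow> 'a ^ ('p + 'q) ^ 'm" where
  "hstack P Q = (\<chi> i. vstack (P $ i) (Q $ i))"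

definition diag_matrix :: "'a::zero ^ 'n \<Rightarrow> 'a ^ 'n ^ 'n" where
  "diag_matrix d = (\<chi> i j. if i = j then d $ i else 0)"

section \<open>Matrix properties\<close>

definition pos_def_matrix :: "real ^ 'n ^ 'n \<Rightarrow> bool" where
  "pos_def_matrix M \<longleftrightarrow> transpose M = M \<and> (\<forall>v. v \<noteq> 0 \<longrightarrow> v \<bullet> (M *v v) > 0)"

definition neg_def_matrix :: "real ^ 'n ^ 'n \<Rightarrow> bool" where
  "neg_def_matrix M \<longleftrightarrow> transpose M = M \<and> (\<forall>v. v \<noteq> 0 \<longrightarrow> v \<bullet> (M *v v) < 0)"

definition is_eigenvalue :: "complex ^ 'n ^ 'n \<Rightarrow> complex \<Rightarrow> bool" where
  "is_eigenvalue M z \<longleftrightarrow> (\<exists>v. v \<noteq> 0 \<and> M *v v = z *s v)"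

definition hurwitz :: "real ^ 'n ^ 'n \<Rightarrow> bool" where
  "hurwitz M \<longleftrightarrow> (\<forall>z. is_eigenvalue (map_matrix complex_of_real M) z \<longrightarrow> Re z < 0)"

text \<open>Columns \<open>b, A b, \<dots>, A\<^sup>n\<^sup>-\<^sup>1 b\<close>.  Powers are iterated applications of the matrix because \<open>(*)\<close> on
  \<open>real ^ 'n ^ 'n\<close> is the entrywise product.\<close>

definition controllability_matrix ::
    "real ^ 'n::{finite,linorder} ^ 'n::{finite,linorder} \<Rightarrow> real ^ 'n::{finite,linorder} \<Rightarrow>
     real ^ 'n::{finite,linorder} ^ 'n::{finite,linorder}" where
  "controllability_matrix A b = (\<chi> i k. (((\<lambda>v. A *v v) ^^ card {..<k}) b) $ i)"

definition controllable ::
    "real ^ 'n::{finite,linorder} ^ 'n::{finite,linorder} \<Rightarrow> real ^ 'n::{finite,linorder} \<Rightarrow> bool" where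
  "controllable A b \<longleftrightarrow> rank (controllability_matrix A b) = CARD('n)"

text \<open>Rows \<open>c\<^sup>T, c\<^sup>T A, \<dots>, c\<^sup>T A\<^sup>n\<^sup>-\<^sup>1\<close>.\<close>

definition observability_matrix ::
    "real ^ 'n::{finite,linorder} \<Rightarrow> real ^ 'n::{finite,linorder} ^ 'n::{finite,linorder} \<Rightarrow>
     real ^ 'n::{finite,linorder} ^ 'n::{finite,linorder}" where
  "observability_matrix c A = (\<chi> k. ((\<lambda>w. w v* A) ^^ card {..<k}) c)"

definition observable ::
    "real ^ 'n::{finite,linorder} \<Rightarrow> real ^ 'n::{finite,linorder} ^ 'n::{finite,linorder} \<Rightarrow> bool" where
  "observable c A \<longleftrightarrow> rank (observability_matrix c A) = CARD('n)"

section \<open>Trajectories\<close>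

text \<open>Caratheodory solutions on \<open>[0, T]\<close>: absolutely continuous functions satisfying the differential
  equation almost everywhere.  This allows discontinuous (e.g. piecewise constant) inputs.\<close>

definition ode_solution ::
    "real \<Rightarrow> (real \<Rightarrow> 'a::euclidean_space \<Rightarrow> 'a) \<Rightarrow> (real \<Rightarrow> 'a) \<Rightarrow> bool" where
  "ode_solution T f x \<longleftrightarrow>
     (\<lambda>s. f s (x s)) absolutely_integrable_on {0..T} \<and>
     (\<forall>t\<in>{0..T}. ((\<lambda>s. f s (x s)) has_integral (x t - x 0)) {0..t})"

definition plant :: "real ^ 'n ^ 'n \<Rightarrow> real ^ 'n \<Rightarrow> real \<Rightarrow> real ^ 'n \<Rightarrow> real ^ 'n" where
  "plant A b u x = A *v x + u *\<^sub>R b"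

definition io_trajectory ::
    "real ^ 'n ^ 'n \<Rightarrow> real ^ 'n \<Rightarrow> real ^ 'n \<Rightarrow> real \<Rightarrow> (real \<Rightarrow> real) \<Rightarrow> (real \<Rightarrow> real) \<Rightarrow> bool" where
  "io_trajectory A b c T u y \<longleftrightarrow>
     u absolutely_integrable_on {0..T} \<and>
     (\<exists>x. ode_solution T (\<lambda>t. plant A b (u t)) x \<and> (\<forall>t\<in>{0..T}. y t = c \<bullet> x t))"

definition filter_dynamics ::
    "real ^ 'n ^ 'n \<Rightarrow> real ^ 'n \<Rightarrow> real \<Rightarrow> real \<Rightarrow> real ^ ('n + 'n) \<Rightarrow> real ^ ('n + 'n)" where
  "filter_dynamics \<Lambda> l y u z =
     vstack (hstack \<Lambda> 0) (hstack 0 \<Lambda>) *v z + vstack (y *\<^sub>R l) (u *\<^sub>R l)"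

text \<open>Column number \<open>k\<close> (zero-based) of a batch is the sample at time \<open>k Ts\<close>.\<close>

definition batch :: "real \<Rightarrow> (real \<Rightarrow> real ^ 'm) \<Rightarrow> real ^ 'N::{finite,linorder} ^ 'm" where
  "batch Ts f = (\<chi> i k. f (real (card {..<k}) * Ts) $ i)"

section \<open>The linear matrix inequality and the closed loop\<close>

definition lmi_solution ::
    "real ^ 'N ^ 'm \<Rightarrow> real ^ 'N ^ 'm \<Rightarrow> real ^ 'm ^ 'N \<Rightarrow> bool" where
  "lmi_solution Z dZ Q \<longleftrightarrow>
     neg_def_matrix (dZ ** Q + transpose Q ** transpose dZ) \<and>
     Z ** Q = transpose Q ** transpose Z \<and> pos_def_matrix (Z ** Q)"

text \<open>The \<open>2n \<times> 2n\<close> matrix \<open>F = [\<Lambda> + l \<theta>\<^sub>1\<^sup>T, l \<theta>\<^sub>2\<^sup>T; 0, \<Lambda>]\<close> and the vector \<open>g = [0; l]\<close>.\<close>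

definition F_matrix ::
    "real ^ 'n ^ 'n \<Rightarrow> real ^ 'n \<Rightarrow> real ^ 'n \<Rightarrow> real ^ 'n \<Rightarrow> real ^ ('n + 'n) ^ ('n + 'n)" where
  "F_matrix \<Lambda> l \<theta>\<^sub>1 \<theta>\<^sub>2 =
     vstack (hstack (\<Lambda> + (columnvector l :: real ^ 1 ^ 'n) ** rowvector \<theta>\<^sub>1)
                    ((columnvector l :: real ^ 1 ^ 'n) ** rowvector \<theta>\<^sub>2))
            (hstack 0 \<Lambda>)"

definition g_vector :: "real ^ 'n \<Rightarrow> real ^ ('n + 'n)" where
  "g_vector l = vstack 0 l"

definition closed_loop ::
    "real ^ 'n ^ 'n \<Rightarrow> real ^ 'n \<Rightarrow> real ^ 'n \<Rightarrow> real ^ 'n ^ 'n \<Rightarrow> real ^ 'n \<Rightarrow> real ^ ('n + 'n) ^ 1 \<Rightarrow>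
     (real ^ 'n) \<times> (real ^ ('n + 'n)) \<Rightarrow> (real ^ 'n) \<times> (real ^ ('n + 'n))" where
  "closed_loop A b c \<Lambda> l K = (\<lambda>(x, z).
     let u = (K *v z) $ 1 in (plant A b u x, filter_dynamics \<Lambda> l (c \<bullet> x) u z))"

text \<open>Global exponential stability of the origin for \<open>x' = f x\<close>.\<close>

definition globally_exponentially_stable :: "('a::real_normed_vector \<Rightarrow> 'a) \<Rightarrow> bool" where
  "globally_exponentially_stable f \<longleftrightarrow>
     (\<exists>M>0. \<exists>\<alpha>>0. \<forall>\<phi>.
        (\<forall>t\<ge>0. (\<phi> has_vector_derivative f (\<phi> t)) (at t within {0..})) \<longrightarrow>
        (\<forall>t\<ge>0. norm (\<phi> t) \<le> M * exp (- \<alpha> * t) * norm (\<phi> 0)))"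

end

theory Submission
  imports Defs
begin

text \<open>
  A linear map is called Lyapunov stable if some positive definite quadratic form decreases along it. This
  passes to adjoints, to cascades, and back along injective intertwining maps, and it implies both the
  Hurwitz property and exponential stability.

  The filter started at rest reproduces the plant through \<open>P\<close>: the error \<open>x - P \<zeta>\<close> obeys
  \<open>e' = (A - P [l; 0] c\<^sup>T) e\<close>, and the modes of this equation are modes of \<open>\<Lambda>\<close>. Hence
  \<open>y = c\<^sup>T P \<zeta> + h\<^sup>T chi\<close> for some \<open>h\<close>, and the data satisfy a linear equation
  \<open>dZ = M Z + B U\<close> with \<open>(M, B)\<close> containing \<open>(F, g)\<close> as a diagonal block. A solution \<open>Q\<close> of the
  inequality is exactly a Lyapunov form \<open>Z Q\<close> for the adjoint of \<open>M + B U Q (Z Q)\<^sup>-\<^sup>1\<close>. Conversely, if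
  \<open>[Z; U]\<close> has full row rank, any such form and gain come from some \<open>Q\<close>; they exist because a gain
  stabilizing \<open>(A, b)\<close> stabilizes the cascade plant-filter through \<open>P\<close>.
\<close>

subsection \<open>Quadratic Lyapunov functions\<close>

text \<open>Linear maps stand in for matrices so that the notion covers product spaces too. Along
  \<open>x' = f x\<close> the form \<open>x \<bullet> W x\<close> has derivative
  \<open>2 * (x \<bullet> W (f x))\<close>.\<close>

definition lyapunov_form :: "('a::euclidean_space \<Rightarrow> 'a) \<Rightarrow> ('a \<Rightarrow> 'a) \<Rightarrow> bool" where
  "lyapunov_form W f \<longleftrightarrow> linear W \<and> (\<forall>x y. W x \<bullet> y = x \<bullet> W y) \<and>
     (\<forall>x. x \<noteq> 0 \<longrightarrow> 0 < x \<bullet> W x) \<and> (\<forall>x. x \<noteq> 0 \<longrightarrow> x \<bullet> W (f x) < 0)"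

definition lyapunov_stable :: "('a::euclidean_space \<Rightarrow> 'a) \<Rightarrow> bool" where
  "lyapunov_stable f \<longleftrightarrow> (\<exists>W. lyapunov_form W f)"

text \<open>By compactness the form attains a positive minimum on the unit sphere; homogeneity of
  degree two spreads the bound to all vectors.\<close>

lemma positive_form_coercive:
  fixes g :: "'a::euclidean_space \<Rightarrow> 'a"
  assumes "linear g" and pos: "\<And>x. x \<noteq> 0 \<Longrightarrow> 0 < x \<bullet> g x"
  obtains m where "0 < m" "\<And>x. m * (norm x)\<^sup>2 \<le> x \<bullet> g x"
proof -
  have cont: "continuous_on (sphere 0 1) (\<lambda>x. x \<bullet> g x)"
    using linear_continuous_on[OF linear_conv_bounded_linear[THEN iffD1, OF \<open>linear g\<close>]]
    by (intro continuous_intros)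
  have ne: "sphere (0::'a) 1 \<noteq> {}" by simp
  obtain x0 where x0: "x0 \<in> sphere 0 1" "\<And>x. x \<in> sphere 0 1 \<Longrightarrow> x0 \<bullet> g x0 \<le> x \<bullet> g x"
    using continuous_attains_inf[OF compact_sphere ne cont] by blast
  have "0 < x0 \<bullet> g x0" using x0(1) by (intro pos) auto
  moreover have "(x0 \<bullet> g x0) * (norm x)\<^sup>2 \<le> x \<bullet> g x" for x
  proof (cases "x = 0")
    case False
    define e where "e = x /\<^sub>R norm x"
    have "e \<in> sphere 0 1" using False by (simp add: e_def)
    hence "x0 \<bullet> g x0 \<le> e \<bullet> g e" by (rule x0)
    moreover have "x = norm x *\<^sub>R e" using False by (simp add: e_def)
    hence "x \<bullet> g x = (norm x)\<^sup>2 * (e \<bullet> g e)"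
      using linear_scale[OF \<open>linear g\<close>]
      by (metis inner_scaleR_left inner_scaleR_right mult.assoc power2_eq_square)
    ultimately show ?thesis by (simp add: mult.commute mult_right_mono)
  qed (simp add: linear_0[OF \<open>linear g\<close>])
  ultimately show ?thesis by (rule that)
qed

text \<open>The pulled-back form is \<open>S\<^sup>T W S\<close>; injectivity of \<open>S\<close>
  keeps both inequalities strict.\<close>

lemma lyapunov_stable_pullback:
  fixes f :: "'a::euclidean_space \<Rightarrow> 'a" and f' :: "'b::euclidean_space \<Rightarrow> 'b"
  assumes "lyapunov_stable f'" and S: "linear S" "inj S" and eq: "\<And>x. S (f x) = f' (S x)"
  shows "lyapunov_stable f"
proof -
  obtain W where W: "lyapunov_form W f'" using assms(1) by (auto simp: lyapunov_stable_def)
  have ne: "S x \<noteq> 0" if "x \<noteq> 0" for x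
    using that S by (metis injD linear_0)
  have "lyapunov_form (\<lambda>x. adjoint S (W (S x))) f"
    unfolding lyapunov_form_def
  proof (intro conjI allI impI)
    show "linear (\<lambda>x. adjoint S (W (S x)))"
      using linear_compose[OF linear_compose[OF S(1)] adjoint_linear[OF S(1)], of W] W
      by (simp add: lyapunov_form_def o_def)
    show "adjoint S (W (S x)) \<bullet> y = x \<bullet> adjoint S (W (S y))" for x y
      using W unfolding lyapunov_form_def adjoint_clauses[OF S(1)] by blast
    show "0 < x \<bullet> adjoint S (W (S x))" "x \<bullet> adjoint S (W (S (f x))) < 0" if "x \<noteq> 0" for x
      using W ne[OF that] unfolding lyapunov_form_def adjoint_clauses[OF S(1)] eq by blast+
  qed
  thus ?thesis by (auto simp: lyapunov_stable_def)
qed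

lemma lyapunov_form_inverse:
  assumes "lyapunov_form W f"
  obtains V where "linear V" "\<And>x. V (W x) = x" "\<And>x. W (V x) = x"
proof -
  have lin: "linear W" and "\<And>x. x \<noteq> 0 \<Longrightarrow> W x \<noteq> 0"
    using assms by (force simp: lyapunov_form_def)+
  hence "inj W" by (metis linear_injective_0)
  thus thesis using linear_injective_isomorphism[OF lin] that by blast
qed

text \<open>The inverse of the quadratic form serves the adjoint map.\<close>

lemma lyapunov_stable_adjoint:
  assumes "linear f" "lyapunov_stable f"
  shows "lyapunov_stable (adjoint f)"
proof -
  obtain W where W: "lyapunov_form W f" using assms(2) by (auto simp: lyapunov_stable_def)
  obtain V where V: "linear V" "\<And>x. V (W x) = x" "\<And>x. W (V x) = x"
    using lyapunov_form_inverse[OF W] by blast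
  have sym: "W x \<bullet> y = x \<bullet> W y" for x y using W by (simp add: lyapunov_form_def)
  have ne: "V x \<noteq> 0" if "x \<noteq> 0" for x
    using that V W by (metis lyapunov_form_def linear_0)
  have symV: "V x \<bullet> y = x \<bullet> V y" for x y by (metis V(3) sym)
  have "0 < V x \<bullet> W (V x)" "V x \<bullet> W (f (V x)) < 0" if "x \<noteq> 0" for x
    using W ne[OF that] by (auto simp: lyapunov_form_def)
  moreover have "x \<bullet> V x = V x \<bullet> W (V x)" for x by (simp only: V inner_commute)
  \<comment> \<open>Move \<open>V\<close> and the adjoint across the inner product and write the
    remaining \<open>x\<close> as \<open>W (V x)\<close>.\<close>
  moreover have "x \<bullet> V (adjoint f x) = V x \<bullet> W (f (V x))" for x
    by (metis V(3) adjoint_works[OF assms(1)] inner_commute sym symV)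
  ultimately have "lyapunov_form V (adjoint f)"
    using V(1) symV unfolding lyapunov_form_def by simp
  thus ?thesis by (auto simp: lyapunov_stable_def)
qed

text \<open>A weighted sum of the two forms works: the coupling term
  \<open>y \<bullet> W (h x)\<close> costs half of the decrease in \<open>y\<close> plus a multiple
  of \<open>(norm x)\<^sup>2\<close>, which a large weight on the form in \<open>x\<close>
  absorbs.\<close>

lemma lyapunov_stable_cascade:
  fixes f :: "'a::euclidean_space \<Rightarrow> 'a" and g :: "'b::euclidean_space \<Rightarrow> 'b"
  assumes lin: "linear f" "linear g" "linear h" and "lyapunov_stable f" "lyapunov_stable g"
  shows "lyapunov_stable (\<lambda>(x, y). (f x, g y + h x))"
proof -
  obtain V W where V: "lyapunov_form V f" and W: "lyapunov_form W g"
    using assms by (auto simp: lyapunov_stable_def)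
  have linVW: "linear V" "linear W" using V W by (auto simp: lyapunov_form_def)
  have "linear (\<lambda>x. - V (f x))" "linear (\<lambda>x. - W (g x))" "linear (\<lambda>x. W (h x))"
    using linear_compose[OF lin(1) linVW(1)] linear_compose[OF lin(2) linVW(2)]
      linear_compose[OF lin(3) linVW(2)] by (auto simp: o_def intro!: linear_compose_neg)
  moreover have "\<And>x. x \<noteq> 0 \<Longrightarrow> 0 < x \<bullet> - V (f x)" "\<And>x. x \<noteq> 0 \<Longrightarrow> 0 < x \<bullet> - W (g x)"
    using V W by (auto simp: lyapunov_form_def)
  ultimately obtain a r C where a: "0 < a" "\<And>x. a * (norm x)\<^sup>2 \<le> x \<bullet> - V (f x)"
    and r: "0 < r" "\<And>x. r * (norm x)\<^sup>2 \<le> x \<bullet> - W (g x)"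
    and C: "\<And>x. norm (W (h x)) \<le> C * norm x"
    by (metis positive_form_coercive linear_bounded_pos)
  \<comment> \<open>The weight makes \<open>k * a\<close> exceed \<open>C\<^sup>2 / r\<close>, twice
    the coefficient left by the Young inequality below. The extra 1 also keeps \<open>k\<close>
    positive if \<open>C = 0\<close>.\<close>
  define k where "k = (C\<^sup>2 / r + 1) / a"
  have k: "k > 0" "k * a = C\<^sup>2 / r + 1" using a(1) r(1) by (auto simp: k_def add_nonneg_pos)
  have dec: "k * (x \<bullet> V (f x)) + y \<bullet> W (g y + h x) < 0" if "(x, y) \<noteq> 0" for x y
  proof -
    define X Y where "X = C\<^sup>2 / r * (norm x)\<^sup>2" and "Y = r * (norm y)\<^sup>2"
    have "y \<bullet> W (h x) \<le> norm y * (C * norm x)"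
      by (rule order_trans[OF norm_cauchy_schwarz mult_left_mono[OF C]]) simp
    also have "\<dots> \<le> (Y + X) / 2"
    proof -
      have "0 \<le> (r * norm y - C * norm x)\<^sup>2 / r" using r(1) by simp
      also have "\<dots> = Y + X - 2 * (norm y * (C * norm x))"
        using r(1) by (simp add: X_def Y_def field_simps power2_eq_square)
      finally show ?thesis by simp
    qed
    finally have 1: "y \<bullet> W (h x) \<le> (Y + X) / 2" .
    have 2: "y \<bullet> W (g y) \<le> - Y" using r(2)[of y] by (simp add: Y_def)
    have "k * (x \<bullet> V (f x)) \<le> k * - (a * (norm x)\<^sup>2)"
      using a(2)[of x] k(1) by (intro mult_left_mono) auto
    also have "\<dots> = - (C\<^sup>2 / r + 1) * (norm x)\<^sup>2" by (simp flip: k(2))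
    finally have 3: "k * (x \<bullet> V (f x)) \<le> - X - (norm x)\<^sup>2"
      by (simp add: X_def algebra_simps)
    have "0 \<le> X" using r(1) by (simp add: X_def)
    moreover have "0 < Y \<or> 0 < (norm x)\<^sup>2" "0 \<le> Y" "0 \<le> (norm x)\<^sup>2"
      using that r(1) by (auto simp: zero_prod_def Y_def)
    ultimately show ?thesis
      using 1 2 3 unfolding linear_add[OF linVW(2)] inner_add_right by argo
  qed
  have "lyapunov_form (\<lambda>(x, y). (k *\<^sub>R V x, W y)) (\<lambda>(x, y). (f x, g y + h x))"
    unfolding lyapunov_form_def
  proof (intro conjI allI impI)
    show "linear (\<lambda>(x, y). (k *\<^sub>R V x, W y))"
      using linVW by (auto intro!: linearI simp: linear_add linear_scale algebra_simps)
  next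
    fix p q :: "'a \<times> 'b"
    show "(case p of (x, y) \<Rightarrow> (k *\<^sub>R V x, W y)) \<bullet> q = p \<bullet> (case q of (x, y) \<Rightarrow> (k *\<^sub>R V x, W y))"
      using V W by (auto simp: lyapunov_form_def split: prod.splits)
  next
    fix p :: "'a \<times> 'b" assume "p \<noteq> 0"
    obtain x y where p: "p = (x, y)" by fastforce
    have "0 \<le> x \<bullet> V x" "0 \<le> y \<bullet> W y" "0 < x \<bullet> V x \<or> 0 < y \<bullet> W y"
      using V W \<open>p \<noteq> 0\<close> unfolding lyapunov_form_def p
      by (metis inner_zero_left less_eq_real_def zero_prod_def)+
    thus "0 < p \<bullet> (case p of (x, y) \<Rightarrow> (k *\<^sub>R V x, W y))"
      using k(1) by (auto simp: p add_pos_nonneg add_nonneg_pos)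
    show "p \<bullet> (case case p of (x, y) \<Rightarrow> (f x, g y + h x) of (x, y) \<Rightarrow> (k *\<^sub>R V x, W y)) < 0"
      using dec \<open>p \<noteq> 0\<close> by (simp add: p)
  qed
  thus ?thesis by (auto simp: lyapunov_stable_def)
qed

section \<open>Decay estimates and uniqueness for differential equations\<close>

lemma gronwall_le:
  fixes q :: "real \<Rightarrow> real"
  assumes "\<And>s. s \<in> {0..t} \<Longrightarrow> (q has_real_derivative q' s) (at s within {0..t})"
    and "\<And>s. s \<in> {0..t} \<Longrightarrow> q' s \<le> k * q s" and "0 \<le> t"
  shows "q t \<le> exp (k * t) * q 0"
proof (cases "t = 0")
  case False
  \<comment> \<open>With the integrating factor \<open>exp (- k * s)\<close> the derivative is
    nonpositive, so a single mean value step on \<open>{0..t}\<close> suffices.\<close>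
  have "((\<lambda>s. exp (- k * s) * q s) has_derivative
      (\<lambda>d. d * (exp (- k * s) * (q' s - k * q s)))) (at s within {0..t})" if "0 \<le> s" "s \<le> t" for s
    by (rule has_field_derivative_imp_has_derivative[THEN has_derivative_eq_rhs])
      (use that in \<open>auto intro!: derivative_eq_intros assms(1) simp: algebra_simps\<close>)
  from mvt_simple[OF _ this] obtain s where "s \<in> {0<..<t}"
    "exp (- k * t) * q t - exp (- k * 0) * q 0 = (t - 0) * (exp (- k * s) * (q' s - k * q s))"
    using False \<open>0 \<le> t\<close> by force
  moreover have "(t - 0) * (exp (- k * s) * (q' s - k * q s)) \<le> 0"
    using assms(2)[of s] \<open>s \<in> _\<close> by (intro mult_nonneg_nonpos) auto
  ultimately have "exp (- k * t) * q t \<le> q 0" by simp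
  hence "exp (k * t) * (exp (- k * t) * q t) \<le> exp (k * t) * q 0" by (intro mult_left_mono) auto
  thus ?thesis by (simp add: mult.assoc[symmetric] exp_add[symmetric])
qed simp

lemma has_real_derivative_form:
  fixes \<phi> :: "real \<Rightarrow> 'a::euclidean_space"
  assumes "linear W" and sym: "\<And>x y. W x \<bullet> y = x \<bullet> W y"
    and "(\<phi> has_vector_derivative d) (at t within S)"
  shows "((\<lambda>s. \<phi> s \<bullet> W (\<phi> s)) has_real_derivative 2 * (\<phi> t \<bullet> W d)) (at t within S)"
proof -
  have "((\<lambda>s. W (\<phi> s)) has_vector_derivative W d) (at t within S)"
    by (rule bounded_linear.has_vector_derivative[OF _ assms(3)])
      (use assms(1) in \<open>simp add: linear_conv_bounded_linear\<close>)
  from bounded_bilinear.has_vector_derivative[OF bounded_bilinear_inner assms(3) this]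
  have "((\<lambda>s. \<phi> s \<bullet> W (\<phi> s)) has_vector_derivative 2 * (\<phi> t \<bullet> W d)) (at t within S)"
    using sym[of d "\<phi> t"] by (simp add: inner_commute[of "W d"])
  thus ?thesis by (simp add: has_real_derivative_iff_has_vector_derivative)
qed

text \<open>The form lies between \<open>m\<close> and \<open>C\<close> times the squared norm,
  hence decays at rate \<open>2 * a / C\<close>. Square roots give the rate \<open>a / C\<close> and
  the overshoot \<open>sqrt (C / m)\<close>.\<close>

lemma lyapunov_stable_imp_exponentially_stable:
  assumes "linear f" "lyapunov_stable f"
  shows "globally_exponentially_stable f"
proof -
  obtain W where W: "lyapunov_form W f" using assms(2) by (auto simp: lyapunov_stable_def)
  have lin: "linear W" and sym: "\<And>x y. W x \<bullet> y = x \<bullet> W y"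
    using W by (auto simp: lyapunov_form_def)
  have "linear (\<lambda>x. - W (f x))"
    using linear_compose[OF assms(1) lin] by (auto simp: o_def intro!: linear_compose_neg)
  moreover have "\<And>x. x \<noteq> 0 \<Longrightarrow> 0 < x \<bullet> - W (f x)" "\<And>x. x \<noteq> 0 \<Longrightarrow> 0 < x \<bullet> W x"
    using W by (auto simp: lyapunov_form_def)
  ultimately obtain a m C where a: "0 < a" "\<And>x. a * (norm x)\<^sup>2 \<le> x \<bullet> - W (f x)"
    and m: "0 < m" "\<And>x. m * (norm x)\<^sup>2 \<le> x \<bullet> W x"
    and C: "0 < C" "\<And>x. norm (W x) \<le> C * norm x"
    using lin by (metis positive_form_coercive linear_bounded_pos)
  have up: "x \<bullet> W x \<le> C * (norm x)\<^sup>2" for x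
    using order_trans[OF norm_cauchy_schwarz mult_left_mono[OF C(2)], of x x]
    by (simp add: power2_eq_square algebra_simps)
  have decay: "norm (\<phi> t) \<le> sqrt (C / m) * exp (- (a / C) * t) * norm (\<phi> 0)"
    if \<phi>: "\<forall>t\<ge>0. (\<phi> has_vector_derivative f (\<phi> t)) (at t within {0..})" and "0 \<le> t" for \<phi> t
  proof -
    have "\<phi> t \<bullet> W (\<phi> t) \<le> exp (- (2 * a / C) * t) * (\<phi> 0 \<bullet> W (\<phi> 0))"
    proof (rule gronwall_le[OF has_real_derivative_form[OF lin sym]])
      fix s assume s: "s \<in> {0..t}"
      show "(\<phi> has_vector_derivative f (\<phi> s)) (at s within {0..t})"
        using \<phi> s by (auto intro: has_vector_derivative_within_subset)
      have "a / C * (\<phi> s \<bullet> W (\<phi> s)) \<le> a / C * (C * (norm (\<phi> s))\<^sup>2)"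
        using a(1) C(1) up by (intro mult_left_mono) auto
      also have "\<dots> = a * (norm (\<phi> s))\<^sup>2" using C(1) by simp
      finally show "2 * (\<phi> s \<bullet> W (f (\<phi> s))) \<le> - (2 * a / C) * (\<phi> s \<bullet> W (\<phi> s))"
        using a(2)[of "\<phi> s"] by (simp add: algebra_simps)
    qed fact
    also have "\<dots> \<le> exp (- (2 * a / C) * t) * (C * (norm (\<phi> 0))\<^sup>2)"
      by (intro mult_left_mono up) auto
    finally have "m * (norm (\<phi> t))\<^sup>2 \<le> exp (- (2 * a / C) * t) * (C * (norm (\<phi> 0))\<^sup>2)"
      using m(2)[of "\<phi> t"] by linarith
    hence "(norm (\<phi> t))\<^sup>2 \<le> C / m * exp (- (2 * a / C) * t) * (norm (\<phi> 0))\<^sup>2"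
      using m(1) by (simp add: field_simps)
    also have "\<dots> = (sqrt (C / m) * exp (- (a / C) * t) * norm (\<phi> 0))\<^sup>2"
      using C(1) m(1) by (simp add: power_mult_distrib power2_eq_square[of "exp _"] exp_add[symmetric])
    finally show ?thesis
      by (rule power2_le_imp_le) (use C(1) m(1) in auto)
  qed
  show ?thesis unfolding globally_exponentially_stable_def
    by (rule exI[of _ "sqrt (C / m)"], rule conjI, use C(1) m(1) in simp,
        rule exI[of _ "a / C"], use C(1) a(1) decay in auto)
qed

text \<open>This is uniqueness for differences of Caratheodory solutions, from which the input has
  cancelled. The integral equation makes \<open>d\<close> continuous, then differentiable, and the
  Gronwall bound applies to the squared norm.\<close>

lemma linear_ode_eq_0:
  fixes d :: "real \<Rightarrow> 'a::euclidean_space"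
  assumes "linear f" and int: "\<And>t. t \<in> {0..T} \<Longrightarrow> ((\<lambda>s. f (d s)) has_integral d t) {0..t}"
    and "t \<in> {0..T}"
  shows "d t = 0"
proof -
  have deq: "d s = integral {0..s} (\<lambda>s. f (d s))" if "s \<in> {0..T}" for s
    using int[OF that] by (simp add: integral_unique)
  have "(\<lambda>s. f (d s)) integrable_on {0..T}"
    using int[of T] assms(3) by (auto simp: has_integral_integrable)
  from indefinite_integral_continuous_1[OF this] have "continuous_on {0..T} d"
    using deq continuous_on_cong by (metis (no_types, lifting))
  hence cont: "continuous_on {0..T} (\<lambda>s. f (d s))"
    using assms(1) linear_conv_bounded_linear bounded_linear.continuous_on by blast
  have der: "(d has_vector_derivative f (d s)) (at s within {0..T})" if "s \<in> {0..T}" for s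
    by (rule has_vector_derivative_transform[OF that _ integral_has_vector_derivative[OF cont that]])
      (rule deq)
  obtain C where C: "\<And>x. norm (f x) \<le> C * norm x"
    using assms(1) linear_bounded_pos by metis
  have "d 0 = 0" using deq[of 0] assms(3) by simp
  have "d t \<bullet> d t \<le> exp (2 * C * t) * (d 0 \<bullet> d 0)"
  proof (rule gronwall_le[OF has_real_derivative_form[of "\<lambda>x. x"]])
    fix s assume s: "s \<in> {0..t}"
    show "(d has_vector_derivative f (d s)) (at s within {0..t})"
      by (rule has_vector_derivative_within_subset[OF der]) (use s assms(3) in auto)
    have "d s \<bullet> f (d s) \<le> norm (d s) * (C * norm (d s))"
      by (rule order_trans[OF norm_cauchy_schwarz mult_left_mono[OF C]]) simp
    thus "2 * (d s \<bullet> (f (d s))) \<le> 2 * C * (d s \<bullet> d s)"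
      by (simp add: power2_norm_eq_inner[symmetric] power2_eq_square algebra_simps)
  qed (use assms(3) linear_ident in auto)
  hence "d t \<bullet> d t \<le> 0" using \<open>d 0 = 0\<close> by simp
  thus ?thesis using inner_gt_zero_iff[of "d t"] by linarith
qed

section \<open>From Lyapunov forms to eigenvalues\<close>

lemma map_matrix_of_real_mult_vec:
  fixes M :: "real ^ 'n ^ 'm" and v :: "complex ^ 'n"
  shows "(\<chi> i. Re ((map_matrix complex_of_real M *v v) $ i)) = M *v (\<chi> i. Re (v $ i))"
    and "(\<chi> i. Im ((map_matrix complex_of_real M *v v) $ i)) = M *v (\<chi> i. Im (v $ i))"
  by (simp_all add: vec_eq_iff matrix_vector_mult_def map_matrix_def Re_sum Im_sum)

text \<open>Split a complex eigenvector into real and imaginary parts and add the two real decrease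
  inequalities.\<close>

lemma lyapunov_stable_imp_hurwitz:
  assumes "lyapunov_stable ((*v) M)"
  shows "hurwitz M"
  unfolding hurwitz_def is_eigenvalue_def
proof clarify
  fix z v assume "v \<noteq> 0" and eig: "map_matrix complex_of_real M *v v = z *s v"
  obtain W where W: "lyapunov_form W ((*v) M)" using assms by (auto simp: lyapunov_stable_def)
  have lin: "linear W" and sym: "\<And>x y. W x \<bullet> y = x \<bullet> W y"
    using W by (auto simp: lyapunov_form_def)
  define p q where "p = (\<chi> i. Re (v $ i))" and "q = (\<chi> i. Im (v $ i))"
  have p: "M *v p = Re z *\<^sub>R p - Im z *\<^sub>R q" and q: "M *v q = Re z *\<^sub>R q + Im z *\<^sub>R p"
    unfolding p_def q_def map_matrix_of_real_mult_vec[symmetric] eig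
    by (simp_all add: vec_eq_iff)
  \<comment> \<open>The terms \<open>- Im z * (p \<bullet> W q)\<close> and
    \<open>Im z * (q \<bullet> W p)\<close> cancel by symmetry of \<open>W\<close>.\<close>
  have "p \<bullet> W (M *v p) + q \<bullet> W (M *v q) = Re z * (p \<bullet> W p + q \<bullet> W q)"
    unfolding p q using sym[of p q]
    by (simp add: linear_add[OF lin] linear_diff[OF lin] linear_scale[OF lin]
        inner_diff_right inner_add_right distrib_left inner_commute)
  moreover have "p \<noteq> 0 \<or> q \<noteq> 0"
    using \<open>v \<noteq> 0\<close> by (auto simp: p_def q_def vec_eq_iff complex_eq_iff)
  hence "p \<bullet> W (M *v p) + q \<bullet> W (M *v q) < 0" "0 < p \<bullet> W p + q \<bullet> W q"
  proof -
    have "x \<bullet> W (M *v x) \<le> 0" "0 \<le> x \<bullet> W x" for x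
      using W unfolding lyapunov_form_def by (metis inner_zero_left less_eq_real_def order_refl)+
    thus "p \<bullet> W (M *v p) + q \<bullet> W (M *v q) < 0" "0 < p \<bullet> W p + q \<bullet> W q"
      using W \<open>p \<noteq> 0 \<or> q \<noteq> 0\<close> unfolding lyapunov_form_def
      by (metis add_neg_nonpos add_nonpos_neg, metis add_pos_nonneg add_nonneg_pos)
  qed
  ultimately show "Re z < 0" by (metis zero_less_mult_pos2 mult_nonneg_nonneg not_less less_imp_le)
qed

subsection \<open>Block vectors\<close>

lemma sum_UNIV_Plus:
  "(\<Sum>k\<in>(UNIV :: ('a::finite + 'b::finite) set). f k) = (\<Sum>i\<in>UNIV. f (Inl i)) + (\<Sum>j\<in>UNIV. f (Inr j))"
  using sum.Plus[of "UNIV :: 'a set" "UNIV :: 'b set" f] by (simp add: UNIV_Plus_UNIV)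

lemma vstack_cases: obtains p q where "v = vstack p q"
proof
  show "v = vstack (\<chi> i. v $ Inl i) (\<chi> i. v $ Inr i)"
    by (simp add: vec_eq_iff vstack_def split: sum.split)
qed

lemma vstack_eq_iff [simp]: "vstack p q = vstack p' q' \<longleftrightarrow> p = p' \<and> q = q'"
proof
  assume "vstack p q = vstack p' q'"
  hence "vstack p q $ Inl i = vstack p' q' $ Inl i" "vstack p q $ Inr j = vstack p' q' $ Inr j" for i j
    by simp_all
  thus "p = p' \<and> q = q'" by (simp add: vec_eq_iff vstack_def)
qed simp

lemma vstack_add: "vstack p q + vstack p' q' = vstack (p + p') (q + q')"
  by (simp add: vec_eq_iff vstack_def split: sum.split)

lemma vstack_scaleR: "k *\<^sub>R vstack p q = vstack (k *\<^sub>R p) (k *\<^sub>R q)"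
  by (simp add: vec_eq_iff vstack_def split: sum.split)

lemma vstack_0: "vstack 0 0 = 0"
  by (simp add: vec_eq_iff vstack_def split: sum.split)

lemma vstack_inner: "vstack p q \<bullet> vstack p' q' = p \<bullet> p' + q \<bullet> (q' :: real ^ 'n)"
  by (simp add: inner_vec_def sum_UNIV_Plus vstack_def)

lemma vstack_mult_vec: "vstack P Q *v x = vstack (P *v x) (Q *v x)"
  by (simp add: vec_eq_iff vstack_def matrix_vector_mult_def split: sum.split)

lemma vstack_matrix_mult: "vstack P Q ** R = vstack (P ** R) (Q ** R)"
  by (simp add: vec_eq_iff vstack_def matrix_matrix_mult_def split: sum.split)

lemma hstack_mult_vstack: "hstack P Q *v vstack p q = P *v p + Q *v q"
  by (simp add: vec_eq_iff hstack_def vstack_def matrix_vector_mult_def sum_UNIV_Plus)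

lemmas vstack_simps = vstack_add vstack_scaleR vstack_0 vstack_inner vstack_mult_vec hstack_mult_vstack

lemma diag_matrix_mult_vec: "diag_matrix d *v x = d * (x :: 'a::semiring_1 ^ 'n)"
  by (simp add: vec_eq_iff diag_matrix_def matrix_vector_mult_def if_distrib[of "\<lambda>t. t * _"] cong: if_cong)

lemma filter_dynamics_vstack:
  "filter_dynamics \<Lambda> l y u (vstack p q) = vstack (\<Lambda> *v p + y *\<^sub>R l) (\<Lambda> *v q + u *\<^sub>R l)"
  by (simp add: filter_dynamics_def vstack_simps)

lemma columnvector_mult_vec:
  "((columnvector l :: real ^ 1 ^ 'n) ** K) *v x = (K *v x) $ 1 *\<^sub>R l"
proof -
  have "columnvector l *v y = y $ 1 *\<^sub>R l" for y :: "real ^ 1"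
    by (simp add: vec_eq_iff matrix_vector_mult_def columnvector_def UNIV_1)
  thus ?thesis by (simp add: matrix_vector_mul_assoc[symmetric])
qed

lemma rowvector_mult_vec: "(rowvector \<theta> *v x) $ 1 = \<theta> \<bullet> (x :: real ^ 'n)"
  by (simp add: matrix_vector_mult_def rowvector_def inner_vec_def)

subsection \<open>Pole placement\<close>

lemma observable_imp_eq_0:
  fixes A :: "real ^ 'n::{finite,linorder} ^ 'n::{finite,linorder}"
  assumes "observable c A" and "\<And>k. k < CARD('n) \<Longrightarrow> ((\<lambda>w. w v* A) ^^ k) c \<bullet> x = 0"
  shows "x = 0"
proof -
  have "card {..<k} < CARD('n)" for k :: 'n
    by (intro psubset_card_mono) auto
  hence "observability_matrix c A *v x = observability_matrix c A *v 0"
    using assms(2) by (simp add: vec_eq_iff matrix_vector_mul_component observability_matrix_def)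
  thus ?thesis using assms(1) full_rank_injective
    by (metis observable_def injD)
qed

text \<open>The observability rows span the space, so the next vector of the orbit of
  \<open>c\<close> depends on them. The numbers \<open>a j\<close> are the coefficients of a monic
  polynomial in \<open>A\<close> that annihilates \<open>c\<close>.\<close>

lemma observable_imp_recurrence:
  fixes A :: "real ^ 'n::{finite,linorder} ^ 'n::{finite,linorder}"
  assumes "observable c A"
  obtains a :: "nat \<Rightarrow> real" where "a CARD('n) = 1"
    "(\<Sum>j\<le>CARD('n). a j *\<^sub>R ((\<lambda>w. w v* A) ^^ j) c) = 0"
proof -
  let ?n = "CARD('n)"
  define orb where "orb k = ((\<lambda>w. w v* A) ^^ k) c" for k
  have "rows (observability_matrix c A) \<subseteq> orb ` {..<?n}"
  proof
    fix r assume "r \<in> rows (observability_matrix c A)"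
    then obtain k where "r = row k (observability_matrix c A)" by (auto simp: rows_def)
    hence "r = orb (card {..<k})"
      by (simp add: row_def observability_matrix_def orb_def vec_nth_inverse)
    moreover have "card {..<k} < ?n" by (intro psubset_card_mono) auto
    ultimately show "r \<in> orb ` {..<?n}" by blast
  qed
  moreover have "span (rows (observability_matrix c A)) = UNIV"
    using assms by (simp add: observable_def row_rank_def dim_eq_full[symmetric])
  ultimately have "orb ?n \<in> span (orb ` {..<?n})" by (metis UNIV_I span_mono subsetD)
  \<comment> \<open>Peeling off one generator at a time yields coefficients indexed by exponents
    rather than by vectors.\<close>
  moreover have "\<exists>a. x = (\<Sum>j<m. a j *\<^sub>R orb j)" if "x \<in> span (orb ` {..<m})" for m x
    using that
  proof (induction m arbitrary: x)
    case (Suc m)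
    hence "x \<in> span (insert (orb m) (orb ` {..<m}))" by (simp add: lessThan_Suc)
    then obtain k where "x - k *\<^sub>R orb m \<in> span (orb ` {..<m})" by (auto simp: span_insert)
    then obtain a where "x - k *\<^sub>R orb m = (\<Sum>j<m. a j *\<^sub>R orb j)" using Suc.IH by blast
    hence "x = (\<Sum>j<Suc m. (a(m := k)) j *\<^sub>R orb j)" by (simp add: algebra_simps)
    thus ?case by blast
  qed simp
  ultimately obtain a where a: "orb ?n = (\<Sum>j<?n. a j *\<^sub>R orb j)" by blast
  have "(\<Sum>j\<le>?n. ((\<lambda>j. - a j)(?n := 1)) j *\<^sub>R orb j) = 0"
    by (simp add: lessThan_Suc_atMost[symmetric] a sum_negf)
  thus ?thesis using that[of "(\<lambda>j. - a j)(?n := 1)"] by (simp add: orb_def)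
qed

text \<open>If \<open>v k = f\<^sup>k v\<^sub>0\<close> for a linear map \<open>f\<close>, then \<open>horner \<mu> v j\<close> is \<open>(f\<^sup>j - \<mu>\<^sup>j) / (f - \<mu>)\<close> applied to \<open>v\<^sub>0\<close>,
  written without division.\<close>

primrec horner :: "real \<Rightarrow> (nat \<Rightarrow> 'a::real_vector) \<Rightarrow> nat \<Rightarrow> 'a" where
  "horner \<mu> v 0 = 0"
| "horner \<mu> v (Suc j) = \<mu> *\<^sub>R horner \<mu> v j + v j"

text \<open>This is \<open>(f - \<mu>) q = f\<^sup>j - \<mu>\<^sup>j\<close> for the quotient
  \<open>q\<close>, applied to \<open>v 0\<close>.\<close>

lemma horner_shift:
  assumes "linear f" and "\<And>k. f (v k) = v (Suc k)"
  shows "f (horner \<mu> v j) = \<mu> *\<^sub>R horner \<mu> v j + v j - \<mu> ^ j *\<^sub>R v 0"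
proof (induction j)
  case (Suc j)
  show ?case
    unfolding horner.simps linear_add[OF assms(1)] linear_scale[OF assms(1)] assms(2) Suc
    by (simp add: algebra_simps)
qed (simp add: linear_0[OF assms(1)])

lemma horner_inner: "horner \<mu> v j \<bullet> x = (\<Sum>m<j. \<mu> ^ m * (v (j - 1 - m) \<bullet> x))"
proof (induction j)
  case (Suc j)
  have "(\<Sum>m<Suc j. \<mu> ^ m * (v (Suc j - 1 - m) \<bullet> x)) =
      v j \<bullet> x + (\<Sum>m<j. \<mu> ^ Suc m * (v (j - Suc m) \<bullet> x))"
    by (subst sum.lessThan_Suc_shift) simp
  thus ?case using Suc by (simp add: inner_add_left sum_distrib_left mult.assoc)
qed simp

text \<open>For fixed \<open>x\<close> the sum is a polynomial in \<open>\<mu>\<close> of degree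
  below \<open>n\<close>. With \<open>n\<close> roots all its coefficients \<open>e m\<close>
  vanish, and since \<open>a n = 1\<close> they form a triangular system in the numbers
  \<open>v k \<bullet> x\<close>.\<close>

lemma horner_combination_inner_eq_0:
  assumes "a n = 1" and "0 < n"
    and roots: "n \<le> card R" "finite R" "\<And>\<mu>. \<mu> \<in> R \<Longrightarrow> (\<Sum>j\<le>n. a j *\<^sub>R horner \<mu> v j) \<bullet> x = 0"
    and "k < n"
  shows "v k \<bullet> x = 0"
proof -
  define e where "e m = (\<Sum>j\<in>{m<..n}. a j * (v (j - 1 - m) \<bullet> x))" for m
  have "(\<Sum>j\<le>n. a j *\<^sub>R horner \<mu> v j) \<bullet> x = (\<Sum>m\<le>n - 1. e m * \<mu> ^ m)" for \<mu>
  proof -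
    have "(\<Sum>j\<le>n. a j *\<^sub>R horner \<mu> v j) \<bullet> x =
        (\<Sum>j\<le>n. \<Sum>m | m < n \<and> m < j. a j * (\<mu> ^ m * (v (j - 1 - m) \<bullet> x)))"
      unfolding inner_sum_left inner_scaleR_left horner_inner sum_distrib_left
      by (intro sum.cong refl) auto
    also have "\<dots> = (\<Sum>m<n. \<Sum>j | j \<le> n \<and> m < j. a j * (\<mu> ^ m * (v (j - 1 - m) \<bullet> x)))"
      using sum.swap_restrict[of "{..n}" "{..<n}" "\<lambda>j m. a j * (\<mu> ^ m * (v (j - 1 - m) \<bullet> x))" "\<lambda>j m. m < j"]
      by simp
    also have "\<dots> = (\<Sum>m\<le>n - 1. e m * \<mu> ^ m)"
    proof (rule sum.cong)
      show "{..<n} = {..n - 1}" using \<open>0 < n\<close> by auto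
      fix m
      have "{j. j \<le> n \<and> m < j} = {m<..n}" by auto
      thus "(\<Sum>j | j \<le> n \<and> m < j. a j * (\<mu> ^ m * (v (j - 1 - m) \<bullet> x))) = e m * \<mu> ^ m"
        by (simp add: e_def sum_distrib_left mult_ac)
    qed
    finally show ?thesis .
  qed
  hence sub: "R \<subseteq> {\<mu>. (\<Sum>m\<le>n - 1. e m * \<mu> ^ m) = 0}" using roots(3) by auto
  have e0: "e m = 0" if "m < n" for m
  proof (rule ccontr)
    assume "e m \<noteq> 0"
    moreover have "m \<le> n - 1" using that by simp
    ultimately have "finite {\<mu>. (\<Sum>m\<le>n - 1. e m * \<mu> ^ m) = 0} \<and>
        card {\<mu>. (\<Sum>m\<le>n - 1. e m * \<mu> ^ m) = 0} \<le> n - 1"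
      using polyfun_rootbound[of "n - 1" e] by blast
    with card_mono[OF _ sub] roots(1) \<open>0 < n\<close> show False by linarith
  qed
  show ?thesis using \<open>k < n\<close>
  proof (induction k rule: less_induct)
    case (less k)
    \<comment> \<open>In this coefficient the summand \<open>j = n\<close> is
      \<open>v k \<bullet> x\<close>; the others involve smaller exponents and vanish by
      induction.\<close>
    have "0 = e (n - 1 - k)" using less.prems e0 by simp
    also have "\<dots> = (\<Sum>j\<in>{n - 1 - k<..n}. if j = n then v k \<bullet> x else 0)"
      unfolding e_def
    proof (intro sum.cong refl)
      fix j assume j: "j \<in> {n - 1 - k<..n}"
      have "v (j - 1 - (n - 1 - k)) \<bullet> x = 0" if "j \<noteq> n"
        using j that less.prems by (intro less.IH) auto
      thus "a j * (v (j - 1 - (n - 1 - k)) \<bullet> x) = (if j = n then v k \<bullet> x else 0)"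
        using less.prems \<open>a n = 1\<close> by auto
    qed
    also have "\<dots> = v k \<bullet> x" using less.prems by simp
    finally show ?case by simp
  qed
qed

text \<open>With \<open>\<alpha>(s) = \<Sum>\<^sub>j a\<^sub>j s\<^sup>j\<close> annihilating \<open>c\<close>, the row for the pole \<open>\<mu>\<close> is \<open>c\<^sup>T q(A)\<close> with
  \<open>q(s) = (\<alpha>(s) - \<alpha>(\<mu>)) / (s - \<mu>)\<close>.  This also works when \<open>\<mu>\<close> is already an eigenvalue of \<open>A\<close>.\<close>

lemma pole_placement:
  fixes A :: "real ^ 'n::{finite,linorder} ^ 'n::{finite,linorder}"
  assumes obs: "observable c A" and inj: "inj (\<lambda>i. d $ i)"
  obtains S V :: "real ^ 'n::{finite,linorder} ^ 'n::{finite,linorder}" and L where "S ** V = mat 1" "V ** S = mat 1"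
    "\<And>x. S *v (A *v x - (c \<bullet> x) *\<^sub>R L) = d * (S *v x)"
proof -
  let ?n = "CARD('n)"
  define orb where "orb k = ((\<lambda>w. w v* A) ^^ k) c" for k
  obtain a where a: "a ?n = 1" "(\<Sum>j\<le>?n. a j *\<^sub>R orb j) = 0"
    using observable_imp_recurrence[OF obs] unfolding orb_def by blast
  define s where "s \<mu> = (\<Sum>j\<le>?n. a j *\<^sub>R horner \<mu> orb j)" for \<mu>
  define \<alpha> where "\<alpha> \<mu> = (\<Sum>j\<le>?n. a j * \<mu> ^ j)" for \<mu>
  define S :: "real ^ 'n::{finite,linorder} ^ 'n::{finite,linorder}" where "S = (\<chi> i. s (d $ i))"
  have lin: "linear (\<lambda>w. w v* A)"
    unfolding transpose_matrix_vector[symmetric] by (rule matrix_vector_mul_linear)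
  have "s \<mu> v* A = (\<Sum>j\<le>?n. a j *\<^sub>R (horner \<mu> orb j v* A))" for \<mu>
    unfolding s_def linear_sum[OF lin] linear_scale[OF lin] ..
  also have "\<dots> \<mu> = (\<Sum>j\<le>?n. a j *\<^sub>R (\<mu> *\<^sub>R horner \<mu> orb j + orb j - \<mu> ^ j *\<^sub>R orb 0))" for \<mu>
    by (subst horner_shift[OF lin]) (simp_all add: orb_def)
  also have "\<dots> \<mu> = \<mu> *\<^sub>R s \<mu> - \<alpha> \<mu> *\<^sub>R c" for \<mu>
    using a(2) by (simp add: scaleR_add_right scaleR_diff_right sum.distrib sum_subtractf s_def \<alpha>_def
        scaleR_sum_right scaleR_sum_left orb_def mult.commute)
  finally have row: "s \<mu> \<bullet> (A *v x) = \<mu> * (s \<mu> \<bullet> x) - \<alpha> \<mu> * (c \<bullet> x)" for \<mu> x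
    by (simp add: dot_lmul_matrix[symmetric] inner_diff_left)
  \<comment> \<open>A kernel vector is orthogonal to the rows for \<open>CARD('n)\<close> distinct
    poles, which gives back all observability conditions.\<close>
  have "x = 0" if "S *v x = 0" for x
  proof (rule observable_imp_eq_0[OF obs])
    fix k assume "k < ?n"
    have "s (d $ i) \<bullet> x = 0" for i
      using that by (simp add: vec_eq_iff matrix_vector_mul_component S_def)
    thus "((\<lambda>w. w v* A) ^^ k) c \<bullet> x = 0"
      using horner_combination_inner_eq_0[of a ?n "range (\<lambda>i. d $ i)" orb x k] a(1) \<open>k < ?n\<close>
      by (auto simp: s_def card_image[OF inj] orb_def)
  qed
  hence "\<exists>V. V ** S = mat 1" by (simp add: matrix_left_invertible_ker)
  then obtain V where V: "V ** S = mat 1" by blast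
  hence V': "S ** V = mat 1" by (simp add: matrix_left_right_inverse)
  \<comment> \<open>The choice gives \<open>s (d $ i) \<bullet> L = - \<alpha> (d $ i)\<close>, so
    the output injection cancels the term \<open>\<alpha> \<mu> * (c \<bullet> x)\<close> in
    \<open>row\<close>.\<close>
  define L where "L = V *v (\<chi> i. - \<alpha> (d $ i))"
  have "S *v (A *v x - (c \<bullet> x) *\<^sub>R L) = d * (S *v x)" for x
  proof -
    have "S *v L = (\<chi> i. - \<alpha> (d $ i))" by (simp add: L_def matrix_vector_mul_assoc V')
    hence "s (d $ i) \<bullet> L = - \<alpha> (d $ i)" for i
      by (simp add: vec_eq_iff matrix_vector_mul_component S_def)
    thus ?thesis
      by (simp add: vec_eq_iff matrix_vector_mul_component S_def inner_diff_right row)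
  qed
  thus ?thesis using that V V' by blast
qed

section \<open>State feedback, and realization of the plant by the filter\<close>

lemma lyapunov_stable_diag:
  fixes d :: "real ^ 'n"
  assumes "\<And>i. d $ i < 0"
  shows "lyapunov_stable (\<lambda>x. d * x)"
proof -
  have "x \<bullet> (d * x) < 0" if nz: "x \<noteq> 0" for x
  proof -
    obtain i where "x $ i \<noteq> 0" using nz by (auto simp: vec_eq_iff)
    hence "0 < (\<Sum>i\<in>UNIV. - d $ i * (x $ i)\<^sup>2)"
      using assms by (intro sum_pos2[of _ i]) (auto simp: less_imp_le mult_neg_pos mult_nonpos_nonneg)
    also have "\<dots> = - (x \<bullet> (d * x))"
      by (simp add: inner_vec_def sum_negf power2_eq_square mult_ac)
    finally show ?thesis by simp
  qed
  hence "lyapunov_form (\<lambda>x. x) (\<lambda>x. d * x)" by (auto simp: lyapunov_form_def linear_ident)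
  thus ?thesis by (auto simp: lyapunov_stable_def)
qed

lemma controllable_iff_observable_transpose: "controllable A b \<longleftrightarrow> observable b (transpose A)"
proof -
  have "controllability_matrix A b = transpose (observability_matrix b (transpose A))"
    by (simp add: controllability_matrix_def observability_matrix_def transpose_def[of "vec_lambda _"]
      transpose_matrix_vector[symmetric])
  thus ?thesis by (simp add: controllable_def observable_def rank_transpose)
qed

text \<open>By duality: poles are placed for the observable pair \<open>b\<close>,
  \<open>transpose A\<close>, and the adjoint of the resulting stable map is \<open>A\<close> with
  the state feedback gain \<open>- L\<close>.\<close>

lemma controllable_imp_stabilizable:
  fixes A :: "real ^ 'n::{finite,linorder} ^ 'n::{finite,linorder}"
  assumes "controllable A b"
  obtains k where "lyapunov_stable (\<lambda>x. A *v x + (k \<bullet> x) *\<^sub>R b)"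
proof -
  \<comment> \<open>The poles are the distinct negative numbers -1, -2, ..., -n.\<close>
  define d :: "real ^ 'n::{finite,linorder}" where "d = (\<chi> i. - 1 - real (card {..<i}))"
  have "card {..<i} < card {..<j}" if "i < j" for i j :: 'n
    using that by (intro psubset_card_mono) auto
  hence "inj (\<lambda>i. d $ i)"
    by (intro linorder_injI) (force simp: d_def)
  then obtain S V :: "real ^ 'n::{finite,linorder} ^ 'n::{finite,linorder}" and L where S: "S ** V = mat 1" "V ** S = mat 1"
    "\<And>x. S *v (transpose A *v x - (b \<bullet> x) *\<^sub>R L) = d * (S *v x)"
    using pole_placement assms unfolding controllable_iff_observable_transpose by metis
  define f where "f x = transpose A *v x - (b \<bullet> x) *\<^sub>R L" for x
  have lin: "linear f"
    unfolding f_def by (intro linearI) (simp_all add: algebra_simps matrix_vector_right_distrib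
        matrix_vector_mult_scaleR inner_add_right)
  have "S *v f x = d * (S *v x)" for x by (simp only: f_def S(3))
  moreover have "inj ((*v) S)" using S(2) by (metis matrix_left_invertible_injective)
  ultimately have "lyapunov_stable f"
    by (intro lyapunov_stable_pullback[OF lyapunov_stable_diag[of d] matrix_vector_mul_linear[of S]])
      (simp_all add: d_def)
  moreover have "adjoint f = (\<lambda>x. A *v x + (- L \<bullet> x) *\<^sub>R b)"
    by (rule adjoint_unique)
      (simp add: f_def inner_diff_left inner_diff_right dot_lmul_matrix[symmetric]
        transpose_matrix_vector inner_commute)
  ultimately show ?thesis using lyapunov_stable_adjoint[OF lin] that by metis
qed

text \<open>The filter realizes the plant on the quotient by the kernel of \<open>P\<close>: the identity says at once
  \<open>P F = A P\<close> and \<open>P g = b\<close>, with \<open>[\<theta>\<^sub>1\<^sup>T \<theta>\<^sub>2\<^sup>T] = c\<^sup>T P\<close> substituted.\<close>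

definition filter_realizes ::
    "real ^ 'n ^ 'n \<Rightarrow> real ^ 'n \<Rightarrow> real ^ 'n \<Rightarrow> real ^ 'n ^ 'n \<Rightarrow> real ^ 'n \<Rightarrow> real ^ ('n + 'n) ^ 'n \<Rightarrow> bool"
  where "filter_realizes A b c \<Lambda> l P \<longleftrightarrow> surj ((*v) P) \<and>
    (\<forall>z u. P *v filter_dynamics \<Lambda> l (c \<bullet> (P *v z)) u z = plant A b u (P *v z))"

text \<open>If \<open>S\<close> diagonalizes \<open>A - L c\<^sup>T\<close>, then
  \<open>w = S x\<close> obeys \<open>w' = d * w + y S L + u S b\<close>. Each coordinate is thus
  matched by a weighted sum of the two filter states of the same index.\<close>

lemma exists_filter_realization:
  fixes A :: "real ^ 'n::{finite,linorder} ^ 'n::{finite,linorder}"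
  assumes con: "controllable A b" and obs: "observable c A"
    and inj: "inj (\<lambda>i. d $ i)" and l: "\<And>i. l $ i \<noteq> 0"
  obtains P where "filter_realizes A b c (diag_matrix d) l P"
proof -
  obtain S V :: "real ^ 'n::{finite,linorder} ^ 'n::{finite,linorder}" and L where SV: "S ** V = mat 1" "V ** S = mat 1"
    and S: "\<And>x. S *v (A *v x - (c \<bullet> x) *\<^sub>R L) = d * (S *v x)"
    using pole_placement[OF obs inj] by metis
  have VS: "V *v (S *v x) = x" "S *v (V *v x) = x" for x
    by (simp_all add: matrix_vector_mul_assoc SV)
  \<comment> \<open>Dividing by \<open>l\<close> compensates for the gains with which
    \<open>y\<close> and \<open>u\<close> enter the filter.\<close>
  define h k where "h = (\<chi> i. (S *v L) $ i / l $ i)" and "k = (\<chi> i. (S *v b) $ i / l $ i)"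
  have hk: "h * l = S *v L" "k * l = S *v b" using l by (simp_all add: h_def k_def vec_eq_iff)
  define P where "P = hstack (V ** diag_matrix h) (V ** diag_matrix k)"
  have P: "P *v vstack p q = V *v (h * p + k * q)" for p q
    by (simp add: P_def hstack_mult_vstack matrix_vector_mul_assoc[symmetric] diag_matrix_mult_vec
        matrix_vector_right_distrib)
  have "P *v filter_dynamics (diag_matrix d) l (c \<bullet> (P *v z)) u z = plant A b u (P *v z)" for z u
  proof -
    obtain p q where z: "z = vstack p q" by (rule vstack_cases)
    define w where "w = h * p + k * q"
    have w: "P *v z = V *v w" by (simp add: z P w_def)
    define y where "y = c \<bullet> (P *v z)"
    have "P *v filter_dynamics (diag_matrix d) l y u z
        = V *v (d * w + y *\<^sub>R (h * l) + u *\<^sub>R (k * l))"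
      unfolding z filter_dynamics_vstack P diag_matrix_mult_vec
      by (rule arg_cong[of _ _ "(*v) V"]) (simp add: w_def vec_eq_iff algebra_simps)
    also have "\<dots> = V *v (d * w) + y *\<^sub>R L + u *\<^sub>R b"
      by (simp add: hk matrix_vector_right_distrib matrix_vector_mult_scaleR VS)
    also have "V *v (d * w) = A *v (V *v w) - (c \<bullet> (V *v w)) *\<^sub>R L"
      using S[of "V *v w"] VS by metis
    finally show ?thesis by (simp add: w y_def plant_def)
  qed
  \<comment> \<open>Surjectivity of \<open>P\<close> is obtained as injectivity of its
    transpose.\<close>
  moreover have "x = 0" if x: "transpose P *v x = 0" for x
  proof -
    define w where "w = transpose V *v x"
    have Vw: "x \<bullet> (V *v y) = w \<bullet> y" for y
      by (simp add: w_def transpose_matrix_vector dot_lmul_matrix)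
    have "x \<bullet> (P *v z) = 0" for z
      using x by (simp add: transpose_matrix_vector dot_lmul_matrix[symmetric])
    hence 0: "w \<bullet> (h * p + k * q) = 0" for p q
      by (metis P Vw)
    have "w $ i = 0" for i
    proof (rule ccontr)
      assume "w $ i \<noteq> 0"
      have "w $ i * h $ i = 0" "w $ i * k $ i = 0"
        using 0[of "axis i 1" 0] 0[of 0 "axis i 1"]
        by (simp_all add: inner_vec_def axis_def if_distrib[of "\<lambda>t. _ * t"] cong: if_cong)
      hence hk0: "(S *v L) $ i = 0" "(S *v b) $ i = 0"
        using \<open>w $ i \<noteq> 0\<close> l[of i] by (simp_all add: h_def k_def)
      \<comment> \<open>Hautus argument: row \<open>i\<close> of \<open>S\<close> is a left
        eigenvector of \<open>A\<close> orthogonal to \<open>b\<close>, hence to all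
        \<open>A\<^sup>k b\<close>. Controllability makes it zero, although \<open>S\<close> is
        invertible.\<close>
      have "(S $ i) \<bullet> (A *v x) = d $ i * ((S $ i) \<bullet> x)" for x
      proof -
        have "(S *v (A *v x - (c \<bullet> x) *\<^sub>R L)) $ i = (d * (S *v x)) $ i" by (simp only: S)
        thus ?thesis using hk0(1) by (simp add: matrix_vector_mul_component inner_diff_right)
      qed
      hence "(S $ i) \<bullet> (((*v) A ^^ k) b) = 0" for k
        by (induction k) (use hk0(2) in \<open>simp_all add: matrix_vector_mul_component\<close>)
      hence "S $ i = 0"
        using con unfolding controllable_iff_observable_transpose
        by (intro observable_imp_eq_0[of b "transpose A"])
          (simp_all add: transpose_matrix_vector[symmetric] inner_commute)
      hence "(S *v (V *v axis i 1)) $ i = 0" by (simp add: matrix_vector_mul_component)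
      thus False by (simp add: VS)
    qed
    hence "w = 0" by (simp add: vec_eq_iff)
    hence "x \<bullet> (V *v (S *v x)) = 0" by (simp add: Vw)
    thus "x = 0" by (simp add: VS)
  qed
  hence "\<exists>B. P ** B = mat 1"
    by (metis matrix_left_invertible_ker right_invertible_transpose transpose_transpose)
  hence "surj ((*v) P)" by (simp add: matrix_right_invertible_surjective)
  ultimately show ?thesis using that unfolding filter_realizes_def by blast
qed

subsection \<open>The filter as an observer\<close>

lemma filter_dynamics_split:
  "filter_dynamics \<Lambda> l y u z = filter_dynamics \<Lambda> l 0 0 z + y *\<^sub>R vstack l 0 + u *\<^sub>R vstack 0 l"
  by (simp add: filter_dynamics_def vstack_simps add.assoc)

lemma linear_filter_dynamics:
  assumes "linear f" "linear g"
  shows "linear (\<lambda>z. filter_dynamics \<Lambda> l (f z) (g z) z)"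
  unfolding filter_dynamics_split[of _ _ "f _"]
  by (intro linearI)
    (simp_all add: filter_dynamics_def vstack_0 matrix_vector_right_distrib matrix_vector_mult_scaleR
      linear_add[OF assms(1)] linear_add[OF assms(2)] linear_scale[OF assms(1)] linear_scale[OF assms(2)]
      algebra_simps)

lemma filter_dynamics_diag: "filter_dynamics (diag_matrix d) l 0 0 z = vstack d d * z"
proof -
  obtain p q where z: "z = vstack p q" by (rule vstack_cases)
  show ?thesis
    unfolding z by (simp add: filter_dynamics_vstack diag_matrix_mult_vec)
      (simp add: vec_eq_iff vstack_def split: sum.split)
qed

lemma lyapunov_stable_filter:
  assumes "\<And>i. d $ i < 0"
  shows "lyapunov_stable (filter_dynamics (diag_matrix d) l 0 0)"
  unfolding filter_dynamics_diag[abs_def]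
  by (rule lyapunov_stable_diag) (use assms in \<open>simp add: vstack_def split: sum.split\<close>)

text \<open>If \<open>y\<close> differs from the predicted output
  \<open>c \<bullet> (P *v z)\<close>, the mismatch enters through the first input channel, so
  \<open>P z\<close> evolves as an observer with injection gain \<open>P [l; 0]\<close>.\<close>

lemma realization_apply:
  assumes "filter_realizes A b c \<Lambda> l P"
  shows "P *v filter_dynamics \<Lambda> l y u z =
    A *v (P *v z) + (y - c \<bullet> (P *v z)) *\<^sub>R (P *v vstack l 0) + u *\<^sub>R b"
proof -
  have "P *v filter_dynamics \<Lambda> l (c \<bullet> (P *v z)) u z = A *v (P *v z) + u *\<^sub>R b"
    using assms by (simp add: filter_realizes_def plant_def)
  thus ?thesis
    unfolding filter_dynamics_split[of _ _ y] filter_dynamics_split[of _ _ "c \<bullet> (P *v z)"]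
    by (simp add: matrix_vector_right_distrib matrix_vector_mult_scaleR algebra_simps)
qed

definition error_map ::
    "real ^ 'n ^ 'n \<Rightarrow> real ^ 'n \<Rightarrow> real ^ 'n \<Rightarrow> real ^ ('n + 'n) ^ 'n \<Rightarrow> real ^ 'n \<Rightarrow> real ^ 'n" where
  "error_map A c l P x = A *v x - (c \<bullet> x) *\<^sub>R (P *v vstack l 0)"

lemma linear_error_map: "linear (error_map A c l P)"
  by (intro linearI) (simp_all add: error_map_def matrix_vector_right_distrib matrix_vector_mult_scaleR
      inner_add_right algebra_simps)

text \<open>With both inputs zero, \<open>P\<close> intertwines the free filter with the observer
  error; this is why error modes are filter modes.\<close>

lemma error_map_filter:
  assumes "filter_realizes A b c \<Lambda> l P"
  shows "error_map A c l P (P *v z) = P *v filter_dynamics \<Lambda> l 0 0 z"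
  unfolding realization_apply[OF assms] by (simp add: error_map_def)

lemma error_dynamics:
  assumes "filter_realizes A b c \<Lambda> l P"
  shows "plant A b u x - P *v filter_dynamics \<Lambda> l (c \<bullet> x) u z = error_map A c l P (x - P *v z)"
  unfolding realization_apply[OF assms]
  by (simp add: error_map_def plant_def matrix_vector_mult_diff_distrib inner_diff_right algebra_simps)

text \<open>\<open>P\<close> is surjective, so the pullback is done for adjoints:
  \<open>transpose P\<close> is injective and intertwines the adjoint error map with the free
  filter, which is symmetric.\<close>

lemma lyapunov_stable_error_map:
  assumes P: "filter_realizes A b c (diag_matrix d) l P" and neg: "\<And>i. d $ i < 0"
  shows "lyapunov_stable (error_map A c l P)"
proof -
  let ?D = "filter_dynamics (diag_matrix d) l 0 0"
  let ?f = "adjoint (error_map A c l P)"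
  note lin = linear_error_map[of A c l P]
  have sym: "?D z \<bullet> z' = z \<bullet> ?D z'" for z z'
    by (simp add: filter_dynamics_diag inner_vec_def mult_ac)
  have "transpose P *v ?f x = ?D (transpose P *v x)" for x
  proof (rule vector_eq_rdot[THEN iffD1], rule allI)
    fix z
    have "(transpose P *v ?f x) \<bullet> z = ?f x \<bullet> (P *v z)"
      by (simp add: transpose_matrix_vector dot_lmul_matrix)
    also have "\<dots> = x \<bullet> (P *v ?D z)"
      by (simp add: adjoint_clauses[OF lin] error_map_filter[OF P])
    also have "\<dots> = ?D (transpose P *v x) \<bullet> z"
      by (simp add: transpose_matrix_vector dot_lmul_matrix sym)
    finally show "(transpose P *v ?f x) \<bullet> z = ?D (transpose P *v x) \<bullet> z" .
  qed
  moreover have "inj ((*v) (transpose P))"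
    using P unfolding filter_realizes_def
    by (metis full_rank_injective full_rank_surjective rank_transpose)
  ultimately have "lyapunov_stable ?f"
    using lyapunov_stable_pullback[OF lyapunov_stable_filter[OF neg] matrix_vector_mul_linear] by blast
  from lyapunov_stable_adjoint[OF adjoint_linear[OF lin] this] show ?thesis
    by (simp add: adjoint_adjoint[OF lin])
qed

text \<open>The estimation error \<open>x - P \<zeta>\<close> is a combination of the modes of the filter, which are the
  components of \<open>chi\<close>.\<close>

lemma io_trajectory_output:
  fixes A :: "real ^ 'n ^ 'n"
  assumes P: "filter_realizes A b c (diag_matrix d) l P"
    and io: "io_trajectory A b c T u y"
    and \<zeta>: "ode_solution T (\<lambda>t. filter_dynamics (diag_matrix d) l (y t) (u t)) \<zeta>" "\<zeta> 0 = 0"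
    and chi: "ode_solution T (\<lambda>t v. diag_matrix d *v v) chi" "chi 0 = 1"
  obtains h where "\<And>t. t \<in> {0..T} \<Longrightarrow> y t = c \<bullet> (P *v \<zeta> t) + h \<bullet> chi t"
proof -
  let ?\<Phi> = "filter_dynamics (diag_matrix d) l"
  obtain x where x: "ode_solution T (\<lambda>t. plant A b (u t)) x" and y: "\<And>t. t \<in> {0..T} \<Longrightarrow> y t = c \<bullet> x t"
    using io by (auto simp: io_trajectory_def)
  obtain w where "x 0 = P *v w"
    using P unfolding filter_realizes_def by (metis surjD)
  then obtain p q where pq: "x 0 = P *v vstack p q" by (metis vstack_cases)
  \<comment> \<open>Here \<open>[p; q]\<close> lifts \<open>x 0\<close> through \<open>P\<close>.
    Since \<open>chi\<close> collects the filter exponentials with initial value 1,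
    \<open>J (chi t)\<close> is the image under \<open>P\<close> of the free filter response from
    that lift.\<close>
  define J where "J v = P *v vstack (p * v) (q * v)" for v
  have J: "linear J"
    unfolding J_def
    by (intro linearI)
      (simp_all add: distrib_left matrix_vector_right_distrib[symmetric]
        matrix_vector_mult_scaleR[symmetric] vstack_simps)
  have J1: "J 1 = x 0" by (simp add: J_def pq)
  have JD: "J (diag_matrix d *v v) = error_map A c l P (J v)" for v
    unfolding J_def error_map_filter[OF P] filter_dynamics_vstack diag_matrix_mult_vec
    by (simp add: mult.left_commute)
  \<comment> \<open>This remainder satisfies the error equation with initial value zero and so
    vanishes, which leaves the coefficient vector \<open>adjoint J c\<close> for
    \<open>chi\<close>.\<close>
  define \<delta> where "\<delta> t = x t - P *v \<zeta> t - J (chi t)" for t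
  have "((\<lambda>s. error_map A c l P (\<delta> s)) has_integral \<delta> t) {0..t}" if t: "t \<in> {0..T}" for t
  proof -
    have "((\<lambda>s. ?\<Phi> (y s) (u s) (\<zeta> s)) has_integral \<zeta> t) {0..t}"
      and "((\<lambda>s. diag_matrix d *v chi s) has_integral (chi t - 1)) {0..t}"
      using \<zeta> chi t by (auto simp: ode_solution_def)
    note int = has_integral_linear[OF this(1) matrix_vector_mul_bounded_linear[of P], unfolded o_def]
      has_integral_linear[OF this(2) linear_conv_bounded_linear[THEN iffD1, OF J], unfolded o_def]
    have "((\<lambda>s. plant A b (u s) (x s)) has_integral (x t - x 0)) {0..t}"
      using x t by (auto simp: ode_solution_def)
    from this int have total: "((\<lambda>s. plant A b (u s) (x s) - P *v ?\<Phi> (y s) (u s) (\<zeta> s) - J (diag_matrix d *v chi s))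
        has_integral (x t - x 0 - P *v \<zeta> t - J (chi t - 1))) {0..t}"
      by (intro has_integral_diff)
    have end_value: "x t - x 0 - P *v \<zeta> t - J (chi t - 1) = \<delta> t"
      by (simp add: \<delta>_def linear_diff[OF J] J1)
    have "plant A b (u s) (x s) - P *v ?\<Phi> (y s) (u s) (\<zeta> s) - J (diag_matrix d *v chi s)
        = error_map A c l P (\<delta> s)" if "s \<in> {0..t}" for s
    proof -
      have "y s = c \<bullet> x s" using that t by (intro y) auto
      thus ?thesis
        unfolding \<delta>_def linear_diff[OF linear_error_map, of _ _ _ _ "x s - P *v \<zeta> s"]
        by (simp only: error_dynamics[OF P] JD)
    qed
    from has_integral_eq[OF this total] show ?thesis by (simp only: end_value)
  qed
  hence \<delta>0: "\<delta> t = 0" if "t \<in> {0..T}" for t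
    using linear_ode_eq_0[OF linear_error_map _ that] by blast
  have "y t = c \<bullet> (P *v \<zeta> t) + adjoint J c \<bullet> chi t" if "t \<in> {0..T}" for t
  proof -
    have "x t = P *v \<zeta> t + J (chi t)" using \<delta>0[OF that] by (simp add: \<delta>_def algebra_simps)
    thus ?thesis using y[OF that] by (simp add: adjoint_clauses[OF J] inner_add_right)
  qed
  thus ?thesis by (rule that)
qed

text \<open>The stabilized plant driving the stable free filter is a stable cascade, and
  \<open>z \<mapsto> (P z, z)\<close> embeds the filter with feedback into it.\<close>

lemma filter_stabilizable:
  fixes A :: "real ^ 'n::{finite,linorder} ^ 'n::{finite,linorder}"
  assumes con: "controllable A b" and P: "filter_realizes A b c (diag_matrix d) l P"
    and neg: "\<And>i. d $ i < 0"
  obtains k where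
    "lyapunov_stable (\<lambda>z. filter_dynamics (diag_matrix d) l (c \<bullet> (P *v z)) (k \<bullet> (P *v z)) z)"
proof -
  let ?D = "filter_dynamics (diag_matrix d) l 0 0"
  obtain k where k: "lyapunov_stable (\<lambda>x. A *v x + (k \<bullet> x) *\<^sub>R b)"
    using controllable_imp_stabilizable[OF con] by blast
  have "lyapunov_stable (\<lambda>(x, z). (A *v x + (k \<bullet> x) *\<^sub>R b,
      ?D z + ((c \<bullet> x) *\<^sub>R vstack l 0 + (k \<bullet> x) *\<^sub>R vstack 0 l)))"
    by (intro lyapunov_stable_cascade k lyapunov_stable_filter neg linear_filter_dynamics[of "\<lambda>_. 0" "\<lambda>_. 0"])
      (auto intro!: linearI linear_zero simp: matrix_vector_right_distrib matrix_vector_mult_scaleR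
        inner_add_right algebra_simps)
  moreover have "linear (\<lambda>z. (P *v z, z))" "inj (\<lambda>z. (P *v z, z))"
    by (auto intro!: linearI injI simp: matrix_vector_right_distrib matrix_vector_mult_scaleR)
  ultimately have
    "lyapunov_stable (\<lambda>z. filter_dynamics (diag_matrix d) l (c \<bullet> (P *v z)) (k \<bullet> (P *v z)) z)"
  proof (rule lyapunov_stable_pullback)
    fix z
    show "(P *v filter_dynamics (diag_matrix d) l (c \<bullet> (P *v z)) (k \<bullet> (P *v z)) z,
        filter_dynamics (diag_matrix d) l (c \<bullet> (P *v z)) (k \<bullet> (P *v z)) z) =
      (case (P *v z, z) of (x, z) \<Rightarrow> (A *v x + (k \<bullet> x) *\<^sub>R b,
        ?D z + ((c \<bullet> x) *\<^sub>R vstack l 0 + (k \<bullet> x) *\<^sub>R vstack 0 l)))"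
      unfolding realization_apply[OF P]
      by (simp add: filter_dynamics_split[of _ _ "c \<bullet> _"] add.assoc)
  qed
  thus ?thesis by (rule that)
qed

text \<open>Separation principle: in the coordinates \<open>(x - P z, z)\<close> the error evolves
  autonomously and drives the stable filter loop through \<open>c \<bullet> e\<close>.\<close>

lemma closed_loop_exponentially_stable:
  assumes P: "filter_realizes A b c (diag_matrix d) l P" and neg: "\<And>i. d $ i < 0"
    and stab: "lyapunov_stable (\<lambda>z. filter_dynamics (diag_matrix d) l (c \<bullet> (P *v z)) ((K *v z) $ 1) z)"
  shows "globally_exponentially_stable (closed_loop A b c (diag_matrix d) l K)"
proof (rule lyapunov_stable_imp_exponentially_stable)
  let ?\<Phi> = "filter_dynamics (diag_matrix d) l"
  show "linear (closed_loop A b c (diag_matrix d) l K)"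
    by (intro linearI)
      (auto simp: closed_loop_def Let_def plant_def filter_dynamics_split[of _ _ "c \<bullet> _"]
        filter_dynamics_split[of _ _ "c \<bullet> _ + _"] filter_dynamics_diag
        matrix_vector_right_distrib matrix_vector_mult_scaleR inner_add_right algebra_simps)
  have lin: "linear (\<lambda>z. c \<bullet> (P *v z))" "linear (\<lambda>z. (K *v z) $ 1)"
    by (auto intro!: linearI simp: matrix_vector_right_distrib matrix_vector_mult_scaleR inner_add_right)
  have "lyapunov_stable (\<lambda>(e, z). (error_map A c l P e,
      ?\<Phi> (c \<bullet> (P *v z)) ((K *v z) $ 1) z + (c \<bullet> e) *\<^sub>R vstack l 0))"
    by (intro lyapunov_stable_cascade linear_error_map linear_filter_dynamics lin stab
        lyapunov_stable_error_map[OF P neg])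
      (auto intro!: linearI simp: inner_add_right algebra_simps)
  moreover have "linear (\<lambda>(x, z). (x - P *v z, z))" "inj (\<lambda>(x, z). (x - P *v z, z))"
    by (auto intro!: linearI injI
        simp: matrix_vector_right_distrib matrix_vector_mult_scaleR algebra_simps)
  ultimately show "lyapunov_stable (closed_loop A b c (diag_matrix d) l K)"
  proof (rule lyapunov_stable_pullback)
    fix w :: "(real ^ 'a) \<times> (real ^ ('a + 'a))"
    obtain x z where w: "w = (x, z)" by fastforce
    define u where "u = (K *v z) $ 1"
    have "?\<Phi> (c \<bullet> x) u z = ?\<Phi> (c \<bullet> (P *v z)) u z + (c \<bullet> (x - P *v z)) *\<^sub>R vstack l 0"
      unfolding filter_dynamics_split[of _ _ "c \<bullet> _"] by (simp add: inner_diff_right algebra_simps)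
    thus "(\<lambda>(x, z). (x - P *v z, z)) (closed_loop A b c (diag_matrix d) l K w) =
      (\<lambda>(e, z). (error_map A c l P e, ?\<Phi> (c \<bullet> (P *v z)) ((K *v z) $ 1) z + (c \<bullet> e) *\<^sub>R vstack l 0))
        ((\<lambda>(x, z). (x - P *v z, z)) w)"
      using error_dynamics[OF P, of u x z] by (simp add: w closed_loop_def Let_def u_def)
  qed
qed

subsection \<open>The linear matrix inequality\<close>

lemma matrix_mult_vec_linear:
  fixes f :: "real ^ 'n \<Rightarrow> real ^ 'm"
  shows "linear f \<Longrightarrow> matrix f *v x = f x"
  by (metis matrix_vector_mul(2))

lemma inner_transpose_add:
  fixes M :: "real ^ 'n ^ 'n"
  shows "x \<bullet> ((M + transpose M) *v x) = 2 * (x \<bullet> (M *v x))"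
  by (simp add: matrix_vector_mult_add_rdistrib inner_add_right transpose_matrix_vector
      dot_lmul_matrix[symmetric] inner_commute)

text \<open>A right inverse of \<open>[Z; U]\<close> realizes any prescribed \<open>Z Q\<close> and
  \<open>U Q\<close>. Taking a Lyapunov form \<open>W\<close> of the adjoint closed loop and
  \<open>\<kappa>\<close> composed with \<open>W\<close> turns \<open>dZ Q\<close> into
  \<open>f\<close> composed with \<open>W\<close>.\<close>

lemma lmi_feasible:
  fixes Z dZ :: "real ^ 'N ^ 'm" and U :: "real ^ 'N ^ 1"
  assumes rank: "rank (vstack Z U) = CARD('m) + 1"
    and data: "\<And>q. dZ *v q = G ((U *v q) $ 1) (Z *v q)"
    and lin: "linear \<kappa>" "linear (\<lambda>v. G (\<kappa> v) v)" and stab: "lyapunov_stable (\<lambda>v. G (\<kappa> v) v)"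
  shows "\<exists>Q. lmi_solution Z dZ Q"
proof -
  define f where "f v = G (\<kappa> v) v" for v
  have f: "linear f" "lyapunov_stable f" using lin stab by (simp_all add: f_def[abs_def])
  obtain W where W: "lyapunov_form W (adjoint f)"
    using lyapunov_stable_adjoint[OF f] by (auto simp: lyapunov_stable_def)
  have linW: "linear W" and sym: "\<And>x y. W x \<bullet> y = x \<bullet> W y" using W by (auto simp: lyapunov_form_def)
  have "surj ((*v) (vstack Z U))"
    using rank by (simp add: full_rank_surjective[symmetric])
  then obtain B where B: "vstack Z U ** B = mat 1" by (auto simp: matrix_right_invertible_surjective[symmetric])
  define Y :: "real ^ 'm ^ 1" where "Y = matrix (\<lambda>x. vec (\<kappa> (W x)))"
  have Y: "Y *v x = vec (\<kappa> (W x))" for x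
    unfolding Y_def
    by (rule matrix_mult_vec_linear) (auto intro!: linearI simp: linear_add linear_scale linW lin(1) vec_eq_iff)
  define Q where "Q = B ** vstack (matrix W) Y"
  have "vstack (Z ** Q) (U ** Q) = vstack (matrix W) Y"
    by (simp add: vstack_matrix_mult[symmetric] Q_def matrix_mul_assoc B)
  hence ZQ: "Z ** Q = matrix W" and UQ: "U ** Q = Y" by simp_all
  have ZQx: "Z *v (Q *v x) = W x" for x
    by (simp add: matrix_vector_mul_assoc ZQ matrix_mult_vec_linear[OF linW])
  have UQx: "U *v (Q *v x) = vec (\<kappa> (W x))" for x
    by (simp add: matrix_vector_mul_assoc UQ Y)
  have "dZ *v (Q *v x) = f (W x)" for x
    by (simp only: data ZQx UQx f_def vec_component)
  moreover have "x \<bullet> W (adjoint f x) = x \<bullet> f (W x)" for x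
    by (simp only: sym[symmetric] adjoint_works[OF f(1)]) (rule inner_commute)
  ultimately have "x \<bullet> ((dZ ** Q) *v x) = x \<bullet> W (adjoint f x)" for x
    by (simp only: matrix_vector_mul_assoc[symmetric])
  hence "x \<bullet> ((dZ ** Q + transpose (dZ ** Q)) *v x) < 0" if "x \<noteq> 0" for x
    using W that unfolding inner_transpose_add lyapunov_form_def by simp
  moreover have "transpose (matrix W) = matrix W"
  proof -
    have "transpose (matrix W) *v x = matrix W *v x" for x
    proof (rule vector_eq_rdot[THEN iffD1], rule allI)
      fix y
      show "(transpose (matrix W) *v x) \<bullet> y = (matrix W *v x) \<bullet> y"
        by (simp add: transpose_matrix_vector dot_lmul_matrix matrix_mult_vec_linear[OF linW] sym)
    qed
    thus ?thesis by (simp add: matrix_eq)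
  qed
  ultimately have "lmi_solution Z dZ Q"
    using W unfolding lmi_solution_def neg_def_matrix_def pos_def_matrix_def
      matrix_transpose_mul[symmetric] ZQ
    by (auto simp: lyapunov_form_def matrix_mult_vec_linear[OF linW] transpose_def[of "_ + _"])
      (simp_all add: vec_eq_iff transpose_def)
  thus ?thesis by blast
qed

text \<open>The gain maps \<open>Z Q x\<close> to \<open>U Q x\<close>, so \<open>dZ Q\<close> is
  the closed loop after \<open>Z Q\<close>. The inequality then says that \<open>Z Q\<close> is a
  Lyapunov form for the adjoint closed loop.\<close>

lemma lmi_solution_stabilizes:
  fixes Z dZ :: "real ^ 'N ^ 'm" and U :: "real ^ 'N ^ 1"
  assumes lmi: "lmi_solution Z dZ Q"
    and data: "\<And>q. dZ *v q = G ((U *v q) $ 1) (Z *v q)"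
    and lin: "\<And>\<kappa>. linear \<kappa> \<Longrightarrow> linear (\<lambda>v. G (\<kappa> v) v)"
  shows "lyapunov_stable (\<lambda>v. G (((U ** Q ** matrix_inv (Z ** Q)) *v v) $ 1) v)"
proof -
  let ?R = "Z ** Q"
  define f where "f v = G (((U ** Q ** matrix_inv ?R) *v v) $ 1) v" for v
  have "linear (\<lambda>v. ((U ** Q ** matrix_inv ?R) *v v) $ 1)"
    by (intro linearI) (simp_all add: matrix_vector_right_distrib matrix_vector_mult_scaleR)
  hence f: "linear f" unfolding f_def[abs_def] by (rule lin)
  have R: "transpose ?R = ?R" "\<And>x. x \<noteq> 0 \<Longrightarrow> 0 < x \<bullet> (?R *v x)"
    and neg: "\<And>x. x \<noteq> 0 \<Longrightarrow> x \<bullet> ((dZ ** Q + transpose (dZ ** Q)) *v x) < 0"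
    using lmi
    unfolding lmi_solution_def pos_def_matrix_def neg_def_matrix_def matrix_transpose_mul[symmetric]
    by blast+
  \<comment> \<open>Definiteness gives invertibility, which makes the chosen
    \<open>matrix_inv\<close> a genuine inverse.\<close>
  have "\<And>x. ?R *v x = 0 \<Longrightarrow> x = 0" using R(2) by force
  hence "invertible ?R"
    by (metis invertible_left_inverse matrix_left_invertible_ker)
  hence "matrix_inv ?R ** ?R = mat 1"
    unfolding invertible_def matrix_inv_def by (rule someI2_ex) blast
  hence inv: "matrix_inv ?R *v (?R *v x) = x" for x by (simp add: matrix_vector_mul_assoc)
  have "f (?R *v x) = (dZ ** Q) *v x" for x
    by (simp add: f_def matrix_vector_mul_assoc[symmetric] data inv[unfolded matrix_vector_mul_assoc[symmetric]])
  hence "x \<bullet> f (?R *v x) < 0" if "x \<noteq> 0" for x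
    using neg[OF that] unfolding inner_transpose_add by simp
  moreover have sym: "(?R *v x) \<bullet> y = x \<bullet> (?R *v y)" for x y
    by (metis R(1) dot_lmul_matrix transpose_matrix_vector)
  moreover have "x \<bullet> (?R *v adjoint f x) = x \<bullet> f (?R *v x)" for x
    by (simp only: sym[symmetric] adjoint_works[OF f]) (rule inner_commute)
  ultimately have "lyapunov_form ((*v) ?R) (adjoint f)"
    using R(2) unfolding lyapunov_form_def by (simp add: matrix_vector_mul_linear)
  hence "lyapunov_stable (adjoint f)" by (auto simp: lyapunov_stable_def)
  from lyapunov_stable_adjoint[OF adjoint_linear[OF f] this] show ?thesis
    unfolding adjoint_adjoint[OF f] by (simp only: f_def[abs_def])
qed

subsection \<open>The sampled data\<close>

definition vtop :: "'a ^ ('m::finite + 'k::finite) \<Rightarrow> 'a ^ 'm" where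
  "vtop v = (\<chi> i. v $ Inl i)"

definition vbot :: "'a ^ ('m::finite + 'k::finite) \<Rightarrow> 'a ^ 'k" where
  "vbot v = (\<chi> i. v $ Inr i)"

lemma vtop_vstack [simp]: "vtop (vstack p q) = p" and vbot_vstack [simp]: "vbot (vstack p q) = q"
  by (simp_all add: vtop_def vbot_def vstack_def vec_eq_iff)

lemma linear_vtop: "linear (vtop :: real ^ ('m::finite + 'k::finite) \<Rightarrow> _)"
  and linear_vbot: "linear (vbot :: real ^ ('m::finite + 'k::finite) \<Rightarrow> _)"
  by (auto intro!: linearI simp: vtop_def vbot_def vec_eq_iff)

text \<open>The measured output is replaced by \<open>c\<^sup>T P \<zeta> + h\<^sup>T chi\<close>,
  so the equations for \<open>chi\<close> and the filter close up without the plant state.\<close>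

definition augmented_dynamics ::
    "real ^ 'n ^ 'n \<Rightarrow> real ^ 'n \<Rightarrow> real ^ 'n \<Rightarrow> real ^ ('n + 'n) ^ 'n \<Rightarrow> real ^ 'n \<Rightarrow>
     real \<Rightarrow> real ^ ('n + ('n + 'n)) \<Rightarrow> real ^ ('n + ('n + 'n))" where
  "augmented_dynamics \<Lambda> l c P h u v =
     vstack (\<Lambda> *v vtop v) (filter_dynamics \<Lambda> l (c \<bullet> (P *v vbot v) + h \<bullet> vtop v) u (vbot v))"

lemma linear_augmented_dynamics: "linear (\<lambda>(u, v). augmented_dynamics \<Lambda> l c P h u v)"
  by (intro linearI)
    (auto simp: augmented_dynamics_def filter_dynamics_def vstack_simps
      linear_add[OF linear_vtop] linear_add[OF linear_vbot]
      linear_scale[OF linear_vtop] linear_scale[OF linear_vbot]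
      matrix_vector_right_distrib matrix_vector_mult_scaleR inner_add_right
      scaleR_add_left scaleR_add_right distrib_left ac_simps)

lemma linear_augmented_feedback:
  assumes "linear \<kappa>"
  shows "linear (\<lambda>v. augmented_dynamics \<Lambda> l c P h (\<kappa> v) v)"
proof -
  have "linear (\<lambda>v. (\<kappa> v, v))"
    by (intro linearI) (simp_all add: linear_add[OF assms] linear_scale[OF assms])
  from linear_compose[OF this linear_augmented_dynamics] show ?thesis by (simp add: o_def)
qed

text \<open>Joint linearity of \<open>G\<close> carries the equation from single samples to all
  combinations of columns.\<close>

lemma linear_data_equation:
  fixes Z dZ :: "real ^ 'N ^ 'm" and U :: "real ^ 'N ^ 1"
  assumes lin: "linear (\<lambda>(u, v). G u v)"
    and col: "\<And>k. column k dZ = G (U $ 1 $ k) (column k Z)"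
  shows "dZ *v q = G ((U *v q) $ 1) (Z *v q)"
proof -
  have "dZ *v q = (\<Sum>k\<in>UNIV. q $ k *\<^sub>R (\<lambda>(u, v). G u v) (U $ 1 $ k, column k Z))"
    by (simp add: matrix_mult_sum col scalar_mult_eq_scaleR)
  also have "\<dots> = (\<lambda>(u, v). G u v) (\<Sum>k\<in>UNIV. q $ k *\<^sub>R (U $ 1 $ k, column k Z))"
    by (simp only: linear_sum[OF lin] linear_scale[OF lin])
  also have "(\<Sum>k\<in>UNIV. q $ k *\<^sub>R (U $ 1 $ k, column k Z)) = ((U *v q) $ 1, Z *v q)"
    by (simp add: prod_eq_iff fst_sum snd_sum matrix_mult_sum[of Z] scalar_mult_eq_scaleR)
      (simp add: matrix_vector_mult_def mult.commute)
  finally show ?thesis by simp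
qed

lemma column_batch: "column k (batch Ts f) = f (real (card {..<k}) * Ts)"
  by (simp add: column_def batch_def vec_eq_iff)

lemma sample_time_in_interval:
  fixes k :: "'N::{finite,linorder}"
  assumes "0 < T"
  shows "real (card {..<k}) * (T / real CARD('N)) \<in> {0..T}"
proof -
  have "card {..<k} \<le> CARD('N)" by (intro card_mono) auto
  hence "real (card {..<k}) * T \<le> T * real CARD('N)" using assms by simp
  thus ?thesis using assms by (simp add: divide_le_eq)
qed

text \<open>The components \<open>chi\<close> decay by themselves and drive the stable filter loop
  through \<open>h\<close>, so this is again a cascade.\<close>

lemma augmented_stabilizable:
  fixes d l :: "real ^ 'n"
  assumes "lyapunov_stable (\<lambda>z. filter_dynamics (diag_matrix d) l (c \<bullet> (P *v z)) (k \<bullet> (P *v z)) z)"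
    and neg: "\<And>i. d $ i < 0"
  shows "lyapunov_stable (\<lambda>v. augmented_dynamics (diag_matrix d) l c P h (k \<bullet> (P *v vbot v)) v)"
proof -
  let ?\<Phi> = "filter_dynamics (diag_matrix d) l"
  have lin: "linear (\<lambda>z. a \<bullet> (P *v z))" for a
    by (intro linearI) (simp_all add: matrix_vector_right_distrib matrix_vector_mult_scaleR inner_add_right)
  have "lyapunov_stable (\<lambda>(x, z). (diag_matrix d *v x,
      ?\<Phi> (c \<bullet> (P *v z)) (k \<bullet> (P *v z)) z + (h \<bullet> x) *\<^sub>R vstack l 0))"
    using assms lyapunov_stable_diag[OF neg]
    by (intro lyapunov_stable_cascade linear_filter_dynamics lin)
      (auto intro!: linearI simp: inner_add_right diag_matrix_mult_vec vec_eq_iff algebra_simps)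
  moreover have "linear (\<lambda>v :: real ^ ('n + ('n + 'n)). (vtop v, vbot v))"
    by (intro linearI) (simp_all add: linear_add[OF linear_vtop] linear_add[OF linear_vbot]
        linear_scale[OF linear_vtop] linear_scale[OF linear_vbot])
  moreover have "inj (\<lambda>v. (vtop v, vbot v) :: (real ^ 'n) \<times> (real ^ ('n + 'n)))"
    by (rule injI) (metis vstack_cases prod.inject vtop_vstack vbot_vstack)
  ultimately show ?thesis
  proof (rule lyapunov_stable_pullback)
    fix v :: "real ^ ('n + ('n + 'n))"
    show "(vtop (augmented_dynamics (diag_matrix d) l c P h (k \<bullet> (P *v vbot v)) v),
        vbot (augmented_dynamics (diag_matrix d) l c P h (k \<bullet> (P *v vbot v)) v)) =
      (case (vtop v, vbot v) of (x, z) \<Rightarrow> (diag_matrix d *v x,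
        ?\<Phi> (c \<bullet> (P *v z)) (k \<bullet> (P *v z)) z + (h \<bullet> x) *\<^sub>R vstack l 0))"
      unfolding augmented_dynamics_def filter_dynamics_split[of _ _ "c \<bullet> _ + _"]
        filter_dynamics_split[of _ _ "c \<bullet> _"]
      by (simp add: scaleR_add_left ac_simps)
  qed
qed

section \<open>The matrices \<open>F\<close> and \<open>g\<close>, and assembly of the
  theorem\<close>

lemma filter_dynamics_add_input:
  "filter_dynamics \<Lambda> l y 0 z + u *\<^sub>R vstack 0 l = filter_dynamics \<Lambda> l y u z"
  by (simp add: filter_dynamics_def vstack_simps add.assoc)

lemma F_matrix_mult_vec:
  "F_matrix \<Lambda> l \<theta>\<^sub>1 \<theta>\<^sub>2 *v z = filter_dynamics \<Lambda> l (vstack \<theta>\<^sub>1 \<theta>\<^sub>2 \<bullet> z) 0 z"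
proof -
  obtain p q where z: "z = vstack p q" by (rule vstack_cases)
  show ?thesis
    unfolding z F_matrix_def filter_dynamics_vstack
    by (simp add: vstack_simps matrix_vector_mult_add_rdistrib columnvector_mult_vec rowvector_mult_vec
        scaleR_add_left add.assoc)
qed

text \<open>The realization identity is affine in \<open>u\<close>: \<open>u = 0\<close> isolates
  the equation for \<open>F\<close>, while \<open>z = 0\<close> and \<open>u = 1\<close> isolate the
  one for \<open>g\<close>. Full rank means surjectivity.\<close>

lemma filter_realizes_iff:
  assumes "vstack \<theta>\<^sub>1 \<theta>\<^sub>2 = c v* P"
  shows "filter_realizes A b c \<Lambda> l P \<longleftrightarrow>
    rank P = CARD('n) \<and> P ** F_matrix \<Lambda> l \<theta>\<^sub>1 \<theta>\<^sub>2 = A ** P \<and> P *v g_vector l = (b :: real ^ 'n)"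
proof -
  have F: "F_matrix \<Lambda> l \<theta>\<^sub>1 \<theta>\<^sub>2 *v z + u *\<^sub>R g_vector l = filter_dynamics \<Lambda> l (c \<bullet> (P *v z)) u z" for z u
    by (simp only: F_matrix_mult_vec assms dot_lmul_matrix g_vector_def filter_dynamics_add_input)
  have "(\<forall>z u. P *v filter_dynamics \<Lambda> l (c \<bullet> (P *v z)) u z = plant A b u (P *v z)) \<longleftrightarrow>
      (\<forall>z u. (P ** F_matrix \<Lambda> l \<theta>\<^sub>1 \<theta>\<^sub>2) *v z + u *\<^sub>R (P *v g_vector l) = (A ** P) *v z + u *\<^sub>R b)"
    by (simp only: F[symmetric] plant_def matrix_vector_right_distrib matrix_vector_mult_scaleR
        matrix_vector_mul_assoc)
  also have "\<dots> \<longleftrightarrow> P ** F_matrix \<Lambda> l \<theta>\<^sub>1 \<theta>\<^sub>2 = A ** P \<and> P *v g_vector l = b"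
  proof safe
    assume *: "\<forall>z u. (P ** F_matrix \<Lambda> l \<theta>\<^sub>1 \<theta>\<^sub>2) *v z + u *\<^sub>R (P *v g_vector l) = (A ** P) *v z + u *\<^sub>R b"
    show "P ** F_matrix \<Lambda> l \<theta>\<^sub>1 \<theta>\<^sub>2 = A ** P"
      using spec[OF spec[OF *], of _ 0] by (simp add: matrix_eq)
    show "P *v g_vector l = b"
      using spec[OF spec[OF *, of 0], of 1] by simp
  qed simp
  finally show ?thesis by (simp add: filter_realizes_def full_rank_surjective)
qed

theorem theorem2:
  fixes A :: "real ^ 'n::{finite,linorder} ^ 'n::{finite,linorder}"
    and b c lam l :: "real ^ 'n::{finite,linorder}"
    and \<Lambda> :: "real ^ 'n::{finite,linorder} ^ 'n::{finite,linorder}"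
    and T Ts :: real
    and u y :: "real \<Rightarrow> real"
    and \<zeta> :: "real \<Rightarrow> real ^ ('n::{finite,linorder} + 'n::{finite,linorder})"
    and chi :: "real \<Rightarrow> real ^ 'n::{finite,linorder}"
    and U :: "real ^ 'N::{finite,linorder} ^ 1"
    and Z dZ :: "real ^ 'N::{finite,linorder} ^
      ('n::{finite,linorder} + ('n::{finite,linorder} + 'n::{finite,linorder}))"
  assumes "controllable A b" and "observable c A"
    and "\<forall>i. 0 < lam $ i" and "strict_mono (\<lambda>i. lam $ i)"
    and "\<Lambda> = diag_matrix (- lam)"
    and "\<forall>i. l $ i \<noteq> 0"
    and "T > 0" and "Ts = T / real CARD('N)"
    and "io_trajectory A b c T u y"
    and "ode_solution T (\<lambda>t. filter_dynamics \<Lambda> l (y t) (u t)) \<zeta>" and "\<zeta> 0 = 0"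
    and "ode_solution T (\<lambda>t v. \<Lambda> *v v) chi" and "chi 0 = 1"
    and "U = batch Ts (\<lambda>t. vec (u t))"
    and "Z = batch Ts (\<lambda>t. vstack (chi t) (\<zeta> t))"
    and "dZ = batch Ts (\<lambda>t. vstack (\<Lambda> *v chi t) (filter_dynamics \<Lambda> l (y t) (u t) (\<zeta> t)))"
  shows "(rank (vstack Z U) = 3 * CARD('n) + 1 \<longrightarrow> (\<exists>Q. lmi_solution Z dZ Q)) \<and>
    (\<forall>Q K. lmi_solution Z dZ Q \<longrightarrow>
       K = U ** Q ** matrix_inv (Z ** Q) ** (vstack 0 (mat 1) :: real ^ ('n + 'n) ^ ('n + ('n + 'n))) \<longrightarrow>
       (\<forall>P \<theta>\<^sub>1 \<theta>\<^sub>2.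
          rank P = CARD('n) \<and>
          P ** F_matrix \<Lambda> l \<theta>\<^sub>1 \<theta>\<^sub>2 = A ** P \<and>
          P *v g_vector l = b \<and>
          vstack \<theta>\<^sub>1 \<theta>\<^sub>2 = c v* P \<longrightarrow>
          hurwitz (F_matrix \<Lambda> l \<theta>\<^sub>1 \<theta>\<^sub>2 + columnvector (g_vector l) ** K)) \<and>
       globally_exponentially_stable (closed_loop A b c \<Lambda> l K))"
proof -
  have neg: "(- lam) $ i < 0" for i using assms(3) by simp
  have "inj (\<lambda>i. lam $ i)" using assms(4) by (rule strict_mono_imp_inj_on)
  hence inj: "inj (\<lambda>i. (- lam) $ i)" by (simp add: inj_on_def)
  note ode = assms(10)[unfolded assms(5)] assms(11) assms(12)[unfolded assms(5)] assms(13)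
  \<comment> \<open>The vector \<open>h\<close> depends on \<open>P\<close>, and \<open>P\<close>
    stays arbitrary because \<open>F\<close> is determined by whichever \<open>P\<close> is
    given.\<close>
  have data: "\<exists>h. \<forall>q. dZ *v q = augmented_dynamics \<Lambda> l c P h ((U *v q) $ 1) (Z *v q)"
    if P: "filter_realizes A b c \<Lambda> l P" for P
  proof -
    obtain h where h: "\<And>t. t \<in> {0..T} \<Longrightarrow> y t = c \<bullet> (P *v \<zeta> t) + h \<bullet> chi t"
      using io_trajectory_output[OF P[unfolded assms(5)] assms(9) ode] by blast
    have "column k dZ = augmented_dynamics \<Lambda> l c P h (U $ 1 $ k) (column k Z)" for k
      using h[OF sample_time_in_interval[OF assms(7), of k]]
      by (simp add: assms(8,14-16) column_batch augmented_dynamics_def)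
        (simp add: batch_def)
    thus ?thesis using linear_data_equation[OF linear_augmented_dynamics] by blast
  qed
  obtain P0 where P0: "filter_realizes A b c \<Lambda> l P0"
    using exists_filter_realization[OF assms(1,2) inj] assms(5,6) by metis
  have feasible: "\<exists>Q. lmi_solution Z dZ Q" if "rank (vstack Z U) = 3 * CARD('n) + 1"
  proof -
    obtain k where k: "lyapunov_stable (\<lambda>z. filter_dynamics \<Lambda> l (c \<bullet> (P0 *v z)) (k \<bullet> (P0 *v z)) z)"
      using filter_stabilizable[OF assms(1) P0[unfolded assms(5)] neg] unfolding assms(5) by blast
    obtain h where h: "\<And>q. dZ *v q = augmented_dynamics \<Lambda> l c P0 h ((U *v q) $ 1) (Z *v q)"
      using data[OF P0] by blast
    have lin: "linear (\<lambda>v. k \<bullet> (P0 *v vbot v))"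
      by (intro linearI) (simp_all add: linear_add[OF linear_vbot] linear_scale[OF linear_vbot]
          matrix_vector_right_distrib matrix_vector_mult_scaleR inner_add_right)
    have "rank (vstack Z U) = CARD('n + ('n + 'n)) + 1"
      using that by simp
    from lmi_feasible[OF this h lin linear_augmented_feedback[OF lin]
        augmented_stabilizable[OF k[unfolded assms(5)] neg, folded assms(5)]]
    show ?thesis .
  qed
  have stabilizes: "lyapunov_stable (\<lambda>z. filter_dynamics \<Lambda> l (c \<bullet> (P *v z)) ((K *v z) $ 1) z)"
    if lmi: "lmi_solution Z dZ Q"
      and K: "K = U ** Q ** matrix_inv (Z ** Q) ** (vstack 0 (mat 1) :: real ^ ('n + 'n) ^ ('n + ('n + 'n)))"
      and P: "filter_realizes A b c \<Lambda> l P" for P Q K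
  proof -
    let ?K = "U ** Q ** matrix_inv (Z ** Q)"
    obtain h where h: "\<And>q. dZ *v q = augmented_dynamics \<Lambda> l c P h ((U *v q) $ 1) (Z *v q)"
      using data[OF P] by blast
    from lmi_solution_stabilizes[OF lmi h linear_augmented_feedback]
    have "lyapunov_stable (\<lambda>v. augmented_dynamics \<Lambda> l c P h ((?K *v v) $ 1) v)" .
    moreover have "linear (vstack 0 :: real ^ ('n + 'n) \<Rightarrow> real ^ ('n + ('n + 'n)))"
      by (intro linearI) (simp_all add: vstack_simps)
    moreover have "inj (vstack 0 :: real ^ ('n + 'n) \<Rightarrow> real ^ ('n + ('n + 'n)))"
      by (rule injI) simp
    \<comment> \<open>The block \<open>[0; I]\<close> in \<open>K\<close> restricts the gain to
      states with \<open>chi = 0\<close>. They form an invariant subspace on which the augmented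
      loop is the filter loop.\<close>
    moreover have "K *v z = ?K *v vstack 0 z" for z
      by (simp add: K matrix_vector_mul_assoc[symmetric] vstack_mult_vec)
    hence "vstack 0 (filter_dynamics \<Lambda> l (c \<bullet> (P *v z)) ((K *v z) $ 1) z) =
        augmented_dynamics \<Lambda> l c P h ((?K *v vstack 0 z) $ 1) (vstack 0 z)" for z
      by (simp add: augmented_dynamics_def)
    ultimately show ?thesis by (rule lyapunov_stable_pullback)
  qed
  have hurwitz: "hurwitz (F_matrix \<Lambda> l \<theta>\<^sub>1 \<theta>\<^sub>2 + columnvector (g_vector l) ** K)"
    if stab: "lyapunov_stable (\<lambda>z. filter_dynamics \<Lambda> l (c \<bullet> (P *v z)) ((K *v z) $ 1) z)"
      and \<theta>: "vstack \<theta>\<^sub>1 \<theta>\<^sub>2 = c v* P" for P \<theta>\<^sub>1 \<theta>\<^sub>2 and K :: "real ^ ('n + 'n) ^ 1"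
  proof (rule lyapunov_stable_imp_hurwitz)
    have "(F_matrix \<Lambda> l \<theta>\<^sub>1 \<theta>\<^sub>2 + columnvector (g_vector l) ** K) *v z =
        filter_dynamics \<Lambda> l (c \<bullet> (P *v z)) ((K *v z) $ 1) z" for z
      by (simp only: matrix_vector_mult_add_rdistrib F_matrix_mult_vec columnvector_mult_vec \<theta>
        dot_lmul_matrix g_vector_def filter_dynamics_add_input)
    thus "lyapunov_stable ((*v) (F_matrix \<Lambda> l \<theta>\<^sub>1 \<theta>\<^sub>2 + columnvector (g_vector l) ** K))"
      using stab by presburger
  qed
  show ?thesis
  proof (intro conjI impI allI)
    fix Q K P \<theta>\<^sub>1 \<theta>\<^sub>2
    assume lmi: "lmi_solution Z dZ Q"
      and K: "K = U ** Q ** matrix_inv (Z ** Q) ** (vstack 0 (mat 1) :: real ^ ('n + 'n) ^ ('n + ('n + 'n)))"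
    \<comment> \<open>The closed loop does not mention a realization, so the constructed
      \<open>P0\<close> serves here.\<close>
    show "globally_exponentially_stable (closed_loop A b c \<Lambda> l K)"
      by (rule closed_loop_exponentially_stable[OF P0[unfolded assms(5)] neg, folded assms(5)])
        (rule stabilizes[OF lmi K P0])
    assume P: "rank P = CARD('n) \<and> P ** F_matrix \<Lambda> l \<theta>\<^sub>1 \<theta>\<^sub>2 = A ** P \<and>
      P *v g_vector l = b \<and> vstack \<theta>\<^sub>1 \<theta>\<^sub>2 = c v* P"
    hence \<theta>: "vstack \<theta>\<^sub>1 \<theta>\<^sub>2 = c v* P" by blast
    with P have "filter_realizes A b c \<Lambda> l P" by (simp only: filter_realizes_iff)
    from hurwitz[OF stabilizes[OF lmi K this] \<theta>]
    show "hurwitz (F_matrix \<Lambda> l \<theta>\<^sub>1 \<theta>\<^sub>2 + columnvector (g_vector l) ** K)" .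
  qed (rule feasible)
qed

end
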